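(* Let $k$ be an odd positive integer. Let $V$ be the $\mathbf{Q}$-subspace of $\mathbf{R}$ generated by the $k-1$ numbers $\sigma(\mathbf{a})$, where $\mathbf{a}$ is an admissible composition of weight $k$ either of the form $(2,\ldots,2,3,2,\ldots,2)$ or of the form $(2,\ldots,2,1,2,\ldots,2)$. Then $V$ is also generated by the $k-1$ real numbers $\pi^{k-2r}\sqrt3\,L(2r,\chi)$ and $\pi^{k-2r-1}\zeta(2r+1)$, where $1\leqslant r\leqslant\frac{k-1}{2}$.
   Context: A composition $(a_1,\ldots,a_r)$ is a finite sequence of positive integers, of weight $\sum a_i$, admissible if $a_1\geqslant2$; in the forms above, blocks of $2$'s may be empty. $\sigma(a_1,\ldots,a_r)=\sum_{n_1>\cdots>n_r>0}\binom{2n_1}{n_1}^{-1}n_1^{-a_1}\cdots n_r^{-a_r}$. $\zeta$ is the Riemann zeta function, $\chi$ the non-principal Dirichlet character modulo $3$, $L(s,\chi)=\sum_{n\geqslant1}\chi(n)n^{-s}$. *)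

theory Defs
  imports "HOL-Analysis.Analysis"
begin

definition composition :: "nat list \<Rightarrow> bool" where
  "composition as \<longleftrightarrow> (\<forall>a\<in>set as. 0 < a)"

definition weight :: "nat list \<Rightarrow> nat" where
  "weight as = sum_list as"

definition admissible :: "nat list \<Rightarrow> bool" where
  "admissible as \<longleftrightarrow> composition as \<and> as \<noteq> [] \<and> 2 \<le> hd as"

definition form_232 :: "nat list \<Rightarrow> bool" where
  "form_232 as \<longleftrightarrow> (\<exists>i j. as = replicate i 2 @ [3] @ replicate j 2)"

definition form_212 :: "nat list \<Rightarrow> bool" where
  "form_212 as \<longleftrightarrow> (\<exists>i j. as = replicate i 2 @ [1] @ replicate j 2)"

definition compositions_V :: "nat \<Rightarrow> nat list set" where
  "compositions_V k = {as. admissible as \<and> weight as = k \<and> (form_232 as \<or> form_212 as)}"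

definition decreasing_tuples :: "nat \<Rightarrow> nat list set" where
  "decreasing_tuples r = {ns. length ns = r \<and> sorted_wrt (>) ns \<and> (\<forall>n\<in>set ns. 0 < n)}"

(* All terms are nonnegative and the central binomial coefficient makes the family summable for
   every composition, so the unordered sum is the iterated series. The value at [] is junk. *)
definition \<sigma> :: "nat list \<Rightarrow> real" where
  "\<sigma> as = (\<Sum>\<^sub>\<infinity>ns\<in>decreasing_tuples (length as).
      inverse (real ((2 * hd ns) choose hd ns)) *
      (\<Prod>i<length as. inverse (real (ns ! i) ^ (as ! i))))"

(* Riemann zeta at an integer s > 1, by its Dirichlet series. *)
definition zeta :: "nat \<Rightarrow> real" where
  "zeta s = (\<Sum>n. 1 / real (Suc n) ^ s)"

(* The unit group modulo 3 has order 2, so this is the only non-principal character. *)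
definition chi3 :: "nat \<Rightarrow> real" where
  "chi3 n = (if n mod 3 = 1 then 1 else if n mod 3 = 2 then - 1 else 0)"

definition L_series :: "nat \<Rightarrow> (nat \<Rightarrow> real) \<Rightarrow> real" where
  "L_series s f = (\<Sum>n. f (Suc n) / real (Suc n) ^ s)"

definition rat_scale :: "rat \<Rightarrow> real \<Rightarrow> real" where
  "rat_scale q x = of_rat q * x"

lemma vector_space_rat_scale: "vector_space rat_scale"
  by unfold_locales (simp_all add: rat_scale_def algebra_simps of_rat_add of_rat_mult)

definition rat_span :: "real set \<Rightarrow> real set" where
  "rat_span = module.span rat_scale"

lemma card_compositions_V:
  assumes "odd k"
  shows "card (compositions_V k) = k - 1"
proof -
  obtain m where k: "k = 2 * m + 1" using assms oddE by blast
  define f3 where "f3 i = replicate i (2::nat) @ [3] @ replicate (m - 1 - i) 2" for i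
  define f1 where "f1 i = replicate (Suc i) (2::nat) @ [1] @ replicate (m - 1 - i) 2" for i
  have hd_tw: "takeWhile (\<lambda>x. x = 2) (replicate i (2::nat) @ c # ys) = replicate i 2"
    if "c \<noteq> 2" for i c ys using that by (induction i) auto
  have inj3: "inj_on f3 {..<m}"
  proof (rule inj_onI)
    fix x y assume "f3 x = f3 y"
    from arg_cong[OF this, of "\<lambda>l. length (takeWhile (\<lambda>x. x = 2) l)"] show "x = y"
      by (simp add: f3_def hd_tw)
  qed
  have inj1: "inj_on f1 {..<m}"
  proof (rule inj_onI)
    fix x y assume "f1 x = f1 y"
    from arg_cong[OF this, of "\<lambda>l. length (takeWhile (\<lambda>x. x = 2) l)"] show "x = y"
      by (simp add: f1_def hd_tw del: replicate_Suc)
  qed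
  have eq: "compositions_V k = f3 ` {..<m} \<union> f1 ` {..<m}"
  proof (intro equalityI subsetI)
    fix as assume "as \<in> compositions_V k"
    then have adm: "admissible as" and w: "weight as = k" and "form_232 as \<or> form_212 as"
      by (auto simp: compositions_V_def)
    then show "as \<in> f3 ` {..<m} \<union> f1 ` {..<m}"
    proof (elim disjE)
      assume "form_232 as"
      then obtain i j where a: "as = replicate i 2 @ [3] @ replicate j 2"
        by (auto simp: form_232_def)
      have s: "i + j + 1 = m" using w k by (simp add: a weight_def sum_list_replicate)
      then have "m - 1 - i = j" by simp
      then have "as = f3 i" by (simp add: a f3_def)
      then show ?thesis using s by auto
    next
      assume "form_212 as"
      then obtain i j where a: "as = replicate i 2 @ [1] @ replicate j 2"
        by (auto simp: form_212_def)
      have s: "i + j = m" using w k by (simp add: a weight_def sum_list_replicate)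
      have "i \<noteq> 0" using adm by (cases i) (auto simp: a admissible_def)
      then obtain i' where i: "i = Suc i'" by (cases i) auto
      then have "m - 1 - i' = j" using s by simp
      then have "as = f1 i'" by (simp add: a f1_def i)
      then show ?thesis using s i by auto
    qed
  next
    fix as assume "as \<in> f3 ` {..<m} \<union> f1 ` {..<m}"
    then show "as \<in> compositions_V k"
    proof
      assume "as \<in> f3 ` {..<m}"
      then obtain i where i: "i < m" and a: "as = f3 i" by auto
      have "admissible as" by (cases i) (auto simp: a f3_def admissible_def composition_def)
      moreover have "weight as = k" using i k by (simp add: a f3_def weight_def sum_list_replicate)
      moreover have "form_232 as" unfolding a f3_def form_232_def by blast
      ultimately show ?thesis by (simp add: compositions_V_def)
    next
      assume "as \<in> f1 ` {..<m}"
      then obtain i where i: "i < m" and a: "as = f1 i" by auto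
      have "admissible as" by (auto simp: a f1_def admissible_def composition_def)
      moreover have "weight as = k" using i k by (simp add: a f1_def weight_def sum_list_replicate)
      moreover have "form_212 as" unfolding a f1_def form_212_def by blast
      ultimately show ?thesis by (simp add: compositions_V_def)
    qed
  qed
  have disj: "f3 ` {..<m} \<inter> f1 ` {..<m} = {}"
  proof -
    have "3 \<in> set (f3 i)" "3 \<notin> set (f1 i)" for i by (auto simp: f3_def f1_def)
    then have "f3 i \<noteq> f1 j" for i j by (metis (no_types))
    then show ?thesis by blast
  qed
  have "card (compositions_V k) = card (f3 ` {..<m}) + card (f1 ` {..<m})"
    unfolding eq by (rule card_Un_disjoint) (use disj in auto)
  then show ?thesis using inj1 inj3 k by (simp add: card_image)
qed

end

theory Submission
  imports Defs "HOL-Real_Asymp.Real_Asymp"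
begin

text \<open>
  Put \<open>F\<^sub>a(s) = \<Sum> (2 - 2 cos s)^n\<^sub>1 / (binom(2n\<^sub>1, n\<^sub>1) n\<^sub>1^a\<^sub>1 \<dots> n\<^sub>r^a\<^sub>r)\<close>, so that \<open>\<sigma>(a) = F\<^sub>a(\<pi>/3)\<close>.
  Then \<open>F\<^sub>2\<^sub>a'' = F\<^sub>a\<close>, \<open>F\<^sub>3\<^sub>a' = cot(s/2) F\<^sub>2\<^sub>a\<close> and \<open>F\<^sub>1\<^sub>a = tan(s/2) F\<^sub>2\<^sub>a'\<close>, whence Taylor's formula
  expresses the two families of sums as integrals over \<open>[0, \<pi>/3]\<close> of \<open>(\<pi>/3 - t)^a t^b\<close> against
  \<open>cot(t/2)\<close> and \<open>tan(t/2)\<close>, with \<open>a + b = k - 1\<close>. Expanding the kernel into its sine series and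
  integrating by parts leaves boundary terms, which are rational multiples of \<open>\<pi>^(k-2q) \<surd>3 L(2q, \<chi>)\<close>
  and \<open>\<pi>^(k-2q-1) \<zeta>(2q+1)\<close>. After rescaling these numbers, the coefficient matrix has 2-integral
  entries and is triangular with odd diagonal modulo 2, hence invertible over the rationals.
\<close>

section \<open>Rational spans and 2-integral matrices\<close>

text \<open>The point pi/3 is special in two ways. The substitution z = 2 - 2 cos s sends it to z =
  1. Moreover 2 sin(pi/6) = 1, so the series of cos(n pi/3)/n, whose value is -log(2 sin(pi/6)),
  vanishes; it is the one boundary series that would lead outside the zeta and L values. The values
  sin(n pi/3) are multiples of chi up to a sign given by the parity of n, and cos(n pi/3) depends
  only on gcd(n, 6). This is why exactly L(2q, chi) and zeta(2q+1) appear. The sine series 2 sum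
  sin(n x) of cot(x/2) diverges pointwise. Hence only its partial sums are integrated, and the error
  is controlled by the Riemann-Lebesgue lemma. No determinant is computed. The denominators 2q of
  the zeta coefficients are the obstacle to working modulo 2: they are compensated by 9^q - 1, by
  4^q, or by the absorption identity for binomials. Modulo 2 the two mixed blocks of the matrix
  vanish, and both diagonal blocks reduce to the binomials (2q-1 choose 2n-2).\<close>

interpretation rat: vector_space rat_scale
  by (rule vector_space_rat_scale)

lemma rat_span_mult:
  assumes "q \<in> \<rat>" "x \<in> rat_span S"
  shows "q * x \<in> rat_span S"
  using assms rat.span_scale[of x S] unfolding rat_span_def rat_scale_def
  by (metis Rats_cases)

lemma rat_span_sum:
  assumes "\<And>i. i \<in> I \<Longrightarrow> f i \<in> rat_span S"
  shows "sum f I \<in> rat_span S"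
  using assms unfolding rat_span_def by (rule rat.span_sum)

lemma rat_span_diff: "x \<in> rat_span S \<Longrightarrow> y \<in> rat_span S \<Longrightarrow> x - y \<in> rat_span S"
  unfolding rat_span_def by (rule rat.span_diff)

lemma rat_span_base: "x \<in> S \<Longrightarrow> x \<in> rat_span S"
  unfolding rat_span_def by (rule rat.span_base)

lemma rat_span_minimal:
  assumes "S \<subseteq> rat_span T"
  shows "rat_span S \<subseteq> rat_span T"
  using assms unfolding rat_span_def by (metis rat.span_mono rat.span_span)

text \<open>The localization of the integers at the prime 2, inside the reals;
  \<open>odd_unit\<close> is its unit group, and \<open>x / 2 \<in> odd_denom\<close> is how
  membership in its maximal ideal is written throughout.\<close>

definition odd_denom :: "real set" where
  "odd_denom = {of_int a / of_int b | a b. odd b}"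

definition odd_unit :: "real set" where
  "odd_unit = {of_int a / of_int b | a b. odd a \<and> odd b}"

lemma odd_denomI: "odd b \<Longrightarrow> x = of_int a / of_int b \<Longrightarrow> x \<in> odd_denom"
  unfolding odd_denom_def by blast

lemma odd_denom_of_int [simp]: "of_int a \<in> odd_denom"
  by (rule odd_denomI[of 1]) auto

lemma odd_denom_of_nat [simp]: "of_nat a \<in> odd_denom"
  using odd_denom_of_int[of "int a"] by simp

lemma odd_denom_numeral [simp]: "numeral a \<in> odd_denom"
  using odd_denom_of_int[of "numeral a"] by simp

lemma odd_denom_1 [simp]: "1 \<in> odd_denom"
  using odd_denom_of_int[of 1] by simp

lemma odd_denom_0 [simp]: "0 \<in> odd_denom"
  using odd_denom_of_int[of 0] by simp

lemma odd_denom_Rats: "x \<in> odd_denom \<Longrightarrow> x \<in> \<rat>"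
  unfolding odd_denom_def by auto

lemma odd_denom_add:
  assumes "x \<in> odd_denom" "y \<in> odd_denom"
  shows "x + y \<in> odd_denom"
proof -
  obtain a b c d where "odd b" "odd d" "x = of_int a / of_int b" "y = of_int c / of_int d"
    using assms unfolding odd_denom_def by blast
  moreover from this have "b \<noteq> 0" "d \<noteq> 0" by auto
  ultimately have "odd (b * d)" "x + y = of_int (a * d + c * b) / of_int (b * d)"
    by (simp_all add: field_simps)
  then show ?thesis by (rule odd_denomI)
qed

lemma odd_denom_mult:
  assumes "x \<in> odd_denom" "y \<in> odd_denom"
  shows "x * y \<in> odd_denom"
proof -
  obtain a b c d where "odd b" "odd d" "x = of_int a / of_int b" "y = of_int c / of_int d"
    using assms unfolding odd_denom_def by blast
  then have "odd (b * d)" "x * y = of_int (a * c) / of_int (b * d)"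
    by auto
  then show ?thesis by (rule odd_denomI)
qed

lemma odd_denom_minus: "x \<in> odd_denom \<Longrightarrow> - x \<in> odd_denom"
  using odd_denom_mult[of "-1" x] odd_denom_of_int[of "-1"] by simp

lemma odd_denom_diff: "x \<in> odd_denom \<Longrightarrow> y \<in> odd_denom \<Longrightarrow> x - y \<in> odd_denom"
  using odd_denom_add[of x "- y"] odd_denom_minus by simp

lemma odd_denom_power: "x \<in> odd_denom \<Longrightarrow> x ^ n \<in> odd_denom"
  by (induction n) (auto intro: odd_denom_mult)

lemma odd_denom_inverse_odd: "odd n \<Longrightarrow> 1 / real n \<in> odd_denom"
  by (rule odd_denomI[where b = "int n" and a = 1]) simp_all

lemma odd_unit_inverse:
  assumes "x \<in> odd_unit"
  shows "x \<noteq> 0" "inverse x \<in> odd_denom"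
proof -
  obtain a b where "odd a" "odd b" "x = of_int a / of_int b"
    using assms unfolding odd_unit_def by blast
  moreover from this have "a \<noteq> 0" "b \<noteq> 0" by auto
  ultimately show "x \<noteq> 0" "inverse x \<in> odd_denom"
    by (simp_all add: odd_denomI[of a _ b])
qed

lemma odd_unit_of_nat: "odd n \<Longrightarrow> real n \<in> odd_unit"
  unfolding odd_unit_def by (rule CollectI, rule exI[of _ "int n"], rule exI[of _ 1]) simp

lemma odd_unit_diff:
  assumes "x \<in> odd_unit" "y / 2 \<in> odd_denom"
  shows "x - y \<in> odd_unit"
proof -
  obtain a b where ab: "odd a" "odd b" "x = of_int a / of_int b"
    using assms unfolding odd_unit_def by blast
  obtain c d where cd: "odd d" "y / 2 = of_int c / of_int d"
    using assms unfolding odd_denom_def by blast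
  have y: "y = 2 * of_int c / of_int d" using cd(2) by simp
  have "odd (a * d - 2 * c * b)" "odd (b * d)" using ab cd by auto
  moreover have "x - y = of_int (a * d - 2 * c * b) / of_int (b * d)"
  proof -
    have "b \<noteq> 0" "d \<noteq> 0" using ab cd by auto
    then show ?thesis unfolding ab(3) y by (simp add: field_simps)
  qed
  ultimately show ?thesis unfolding odd_unit_def by blast
qed

text \<open>Gaussian elimination: a matrix over the local ring \<open>odd_denom\<close> that is triangular with unit
  diagonal modulo the maximal ideal generated by 2 is invertible.\<close>

lemma rat_span_triangular_mod_2:
  fixes M :: "'a \<Rightarrow> 'a \<Rightarrow> real" and v w :: "'a \<Rightarrow> real" and rank :: "'a \<Rightarrow> nat"
  assumes "finite I"
    and "\<And>i j. i \<in> I \<Longrightarrow> j \<in> I \<Longrightarrow> M i j \<in> odd_denom"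
    and "\<And>i. i \<in> I \<Longrightarrow> M i i \<in> odd_unit"
    and "\<And>i j. i \<in> I \<Longrightarrow> j \<in> I \<Longrightarrow> i \<noteq> j \<Longrightarrow> rank j \<le> rank i \<Longrightarrow> M i j / 2 \<in> odd_denom"
    and "\<And>i. i \<in> I \<Longrightarrow> v i = (\<Sum>j\<in>I. M i j * w j)"
  shows "\<forall>j\<in>I. w j \<in> rat_span (v ` I)"
  using assms
proof (induction arbitrary: M v rule: finite_ranking_induct[where f = rank])
  case empty
  then show ?case by simp
next
  case (insert x S)
  show ?case
  proof (cases "x \<in> S")
    case True
    then have "insert x S = S" by blast
    then show ?thesis using insert.IH[of M v] insert.prems by simp
  next
    case False
    note ins = insert.prems
    have unit: "M x x \<noteq> 0" "inverse (M x x) \<in> odd_denom"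
      using odd_unit_inverse ins(2)[of x] by auto
    \<comment> \<open>\<open>x\<close> is inserted last and so has maximal rank; its row is
      therefore even off the diagonal.\<close>
    have even_x: "M x j / 2 \<in> odd_denom" if "j \<in> S" for j
      using ins(3)[of x j] insert.hyps(2)[OF that] that False by auto
    define c where "c i = M i x * inverse (M x x)" for i
    have c: "c i \<in> odd_denom" if "i \<in> S" for i
      unfolding c_def using that by (intro odd_denom_mult ins unit) auto
    have half: "c i * M x j / 2 \<in> odd_denom" if "i \<in> S" "j \<in> S" for i j
      using odd_denom_mult[OF c[OF that(1)] even_x[OF that(2)]] by simp
    define M' where "M' i j = M i j - c i * M x j" for i j
    define v' where "v' i = v i - c i * v x" for i
    have vx: "v x = M x x * w x + (\<Sum>j\<in>S. M x j * w j)"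
      using ins(4)[of x] insert.hyps False by simp
    have "\<forall>j\<in>S. w j \<in> rat_span (v' ` S)"
    proof (rule insert.IH[of M' v'])
      fix i j assume ij: "i \<in> S" "j \<in> S"
      show "M' i j \<in> odd_denom" unfolding M'_def
        using ij by (intro odd_denom_diff odd_denom_mult c ins) auto
      assume "i \<noteq> j" "rank j \<le> rank i"
      then have "M i j / 2 \<in> odd_denom" using ins(3) ij by auto
      then show "M' i j / 2 \<in> odd_denom"
        unfolding M'_def using half[OF ij] by (simp add: diff_divide_distrib odd_denom_diff)
    next
      fix i assume i: "i \<in> S"
      show "M' i i \<in> odd_unit" unfolding M'_def
        using i by (intro odd_unit_diff half ins) auto
      have "v i = M i x * w x + (\<Sum>j\<in>S. M i j * w j)"
        using ins(4)[of i] i insert.hyps False by simp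
      moreover have "c i * M x x = M i x" using unit by (simp add: c_def)
      ultimately show "v' i = (\<Sum>j\<in>S. M' i j * w j)"
        by (simp add: v'_def M'_def vx ring_distribs sum_subtractf sum_distrib_left
            flip: mult.assoc)
    qed
    moreover have "rat_span (v' ` S) \<subseteq> rat_span (v ` insert x S)"
    proof (intro rat_span_minimal subsetI)
      fix y assume "y \<in> v' ` S"
      then obtain i where "i \<in> S" "y = v i - c i * v x" by (auto simp: v'_def)
      then show "y \<in> rat_span (v ` insert x S)"
        using rat_span_base[of "v i" "v ` insert x S"] rat_span_base[of "v x" "v ` insert x S"]
        by (auto intro!: rat_span_diff rat_span_mult odd_denom_Rats c)
    qed
    ultimately have S: "w j \<in> rat_span (v ` insert x S)" if "j \<in> S" for j
      using that by blast
    have "w x = inverse (M x x) * (v x - (\<Sum>j\<in>S. M x j * w j))"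
      using unit vx by (simp add: field_simps)
    moreover have "\<dots> \<in> rat_span (v ` insert x S)"
      using ins(1) by (intro rat_span_mult rat_span_diff rat_span_sum S)
        (auto intro: odd_denom_Rats unit rat_span_base)
    ultimately show ?thesis using S by auto
  qed
qed

text \<open>Lifting the exponent: starting from 9 - 1 = 8, each squaring contributes a further
  factor 9^(2^e) + 1, which is even. So 2^(e+3) divides 9^q - 1 when 2^e is the exact power of 2 in
  q.\<close>

lemma nine_power_minus_1_div:
  assumes "0 < q"
  shows "(9 ^ q - 1) / (8 * real q) \<in> odd_denom"
proof -
  obtain e c where q: "q = 2 ^ e * c" and "odd c"
    by (rule multiplicity_decompose'[of q 2]) (use assms in auto)
  have dvd: "(2::int) ^ (e + 3) dvd 9 ^ (2 ^ e) - 1"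
  proof (induction e)
    case (Suc e)
    have "(9::int) ^ (2 ^ Suc e) - 1 = (9 ^ (2 ^ e) - 1) * (9 ^ (2 ^ e) + 1)"
      by (simp add: algebra_simps flip: power_add mult_2)
    moreover have "(2::int) dvd 9 ^ (2 ^ e) + 1" by simp
    ultimately show ?case
      unfolding add_Suc power_Suc2 using mult_dvd_mono[OF Suc] by simp
  qed simp
  moreover have "(9::int) ^ (2 ^ e) - 1 dvd (9 ^ (2 ^ e)) ^ c - 1"
    by (metis dvd_triv_left power_diff_1_eq)
  ultimately have "(2::int) ^ (e + 3) dvd 9 ^ q - 1"
    unfolding q power_mult by (rule dvd_trans)
  then obtain d where "(9::int) ^ q - 1 = 2 ^ (e + 3) * d" by blast
  then have "real_of_int (9 ^ q - 1) = of_int (2 ^ (e + 3) * d)" by simp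
  then have "(9 ^ q - 1) / (8 * real q) = of_int d / of_int (int c)"
    using \<open>odd c\<close> by (simp add: q power_add field_simps)
  then show ?thesis using \<open>odd c\<close> by (intro odd_denomI[of "int c"]) auto
qed

text \<open>If 2^e is the exact power of 2 in q, then e < 2^e <= q, hence the exponent e + 2 of 2 in
  4 q is at most 2 q.\<close>

lemma four_power_div:
  assumes "0 < q"
  shows "4 ^ q / (4 * real q) \<in> odd_denom"
proof -
  obtain e c where q: "q = 2 ^ e * c" and "odd c"
    by (rule multiplicity_decompose'[of q 2]) (use assms in auto)
  have "e < 2 ^ e" by simp
  also have "2 ^ e \<le> q" using q assms by (cases c) auto
  finally have "e + 2 \<le> 2 * q" using assms by linarith
  then have "(4::real) ^ q = 2 ^ (e + 2) * 2 ^ (2 * q - (e + 2))"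
    by (subst power_add [symmetric], subst le_add_diff_inverse) (simp_all only: power_mult, simp)
  then have "4 ^ q / (4 * real q) = of_int (2 ^ (2 * q - (e + 2))) / of_int (int c)"
    using \<open>odd c\<close> by (simp add: q power_add field_simps)
  then show ?thesis using \<open>odd c\<close> by (intro odd_denomI[of "int c"]) auto
qed

section \<open>The power series of a multiple Apery-like sum\<close>

text \<open>The part of the sum with largest index n, without the binomial factor. The empty
  composition is placed at index 0, so that the inner sum over m < n equals 1 exactly for n > 0 at
  the end of the recursion; nonempty compositions vanish at 0.\<close>

fun nested_coeff :: "nat list \<Rightarrow> nat \<Rightarrow> real" where
  "nested_coeff [] n = of_bool (n = 0)"
| "nested_coeff (a # as) n = inverse (real n ^ a) * (\<Sum>m<n. nested_coeff as m)"

lemma nested_coeff_nonneg: "0 \<le> nested_coeff as n"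
  by (induction as n rule: nested_coeff.induct) (auto intro!: mult_nonneg_nonneg sum_nonneg)

lemma nested_coeff_le: "nested_coeff as n \<le> (real n + 1) ^ length as"
proof (induction as arbitrary: n)
  case (Cons a as)
  show ?case
  proof (cases "n = 0")
    case False
    have "(\<Sum>m<n. nested_coeff as m) \<le> (\<Sum>m<n. (real n + 1) ^ length as)"
      by (intro sum_mono order.trans[OF Cons] power_mono) auto
    also have "\<dots> = real n * (real n + 1) ^ length as" by simp
    also have "\<dots> \<le> (real n + 1) * (real n + 1) ^ length as"
      by (intro mult_right_mono) auto
    finally have le: "(\<Sum>m<n. nested_coeff as m) \<le> (real n + 1) ^ length (a # as)" by simp
    have "inverse (real n ^ a) \<le> 1" using False by (simp add: inverse_le_1_iff)
    then have "nested_coeff (a # as) n \<le> 1 * (\<Sum>m<n. nested_coeff as m)"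
      unfolding nested_coeff.simps by (intro mult_right_mono sum_nonneg nested_coeff_nonneg)
    with le show ?thesis by linarith
  qed simp
qed auto

definition apery_fps :: "nat list \<Rightarrow> real fps" where
  "apery_fps as = Abs_fps (\<lambda>n. nested_coeff as n / real ((2 * n) choose n))"

lemma apery_fps_nth [simp]:
  "fps_nth (apery_fps as) n = nested_coeff as n / real ((2 * n) choose n)"
  by (simp add: apery_fps_def)

text \<open>Central binomials grow like 4^n up to a polynomial factor, while
  \<open>nested_coeff\<close> grows polynomially. Radius 2 suffices, since 0 <= 2 - 2 cos s < 2 for
  |s| < pi/2.\<close>

lemma fps_conv_radius_apery: "2 \<le> fps_conv_radius (apery_fps as)"
proof -
  define r where "r = length as"
  have "summable (\<lambda>n. fps_nth (apery_fps as) n * 2 ^ n)"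
  proof (rule summable_comparison_test_ev)
    have "summable (\<lambda>n. (real n + 1) ^ (r + 1) * (1 / 2) ^ n)"
    proof (rule summable_comparison_test_bigo)
      show "summable (\<lambda>n. norm ((3 / 4 :: real) ^ n))" by (simp add: summable_geometric)
      show "(\<lambda>n. (real n + 1) ^ (r + 1) * (1 / 2) ^ n) \<in> O(\<lambda>n. (3 / 4) ^ n)"
        by real_asymp
    qed
    then show "summable (\<lambda>n. 2 * ((real n + 1) ^ (r + 1) * (1 / 2) ^ n))"
      by (rule summable_mult)
    show "\<forall>\<^sub>F n in sequentially. norm (fps_nth (apery_fps as) n * 2 ^ n)
            \<le> 2 * ((real n + 1) ^ (r + 1) * (1 / 2) ^ n)"
      using eventually_gt_at_top[of 0]
    proof eventually_elim
      case (elim n)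
      have pos: "4 ^ n / (2 * real n) > 0" using elim by simp
      have "nested_coeff as n / real ((2 * n) choose n) * 2 ^ n
              \<le> (real n + 1) ^ r / (4 ^ n / (2 * real n)) * 2 ^ n"
        using central_binomial_lower_bound[OF elim] nested_coeff_le[of as n] pos
        by (intro mult_right_mono frac_le) (auto simp: r_def)
      also have "\<dots> = (real n + 1) ^ r * (2 * real n) * (1 / 2) ^ n"
        using elim by (simp add: field_simps power_mult_distrib flip: power_mult_distrib)
      also have "\<dots> \<le> (real n + 1) ^ r * (2 * (real n + 1)) * (1 / 2) ^ n"
        by (intro mult_right_mono mult_left_mono) auto
      also have "\<dots> = 2 * ((real n + 1) ^ (r + 1) * (1 / 2) ^ n)" by simp
      finally show ?case using nested_coeff_nonneg[of as n] by simp
    qed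
  qed
  from conv_radius_geI[OF this] show ?thesis
    by (simp add: fps_conv_radius_def)
qed

section \<open>Summation over decreasing tuples, graded by the largest entry\<close>

lemma decreasing_tuples_0: "decreasing_tuples 0 = {[]}"
  by (auto simp: decreasing_tuples_def)

text \<open>Removing the head leaves a tuple graded by its own, smaller head, which is the recursion
  of \<open>nested_coeff\<close>. The case r = 0 is separate because the head of [] is
  meaningless.\<close>

lemma decreasing_tuples_Suc_head:
  "{ns \<in> decreasing_tuples (Suc r). hd ns = n} =
     (if n = 0 then {} else (#) n ` (if r = 0 then {[]}
       else (\<Union>m<n. {ns \<in> decreasing_tuples r. hd ns = m})))"
proof -
  have "ns \<in> decreasing_tuples (Suc r) \<and> hd ns = n \<longleftrightarrow>
    0 < n \<and> (\<exists>ms. ns = n # ms \<and> ms \<in> decreasing_tuples r \<and> (r = 0 \<or> hd ms < n))" for ns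
  proof (cases ns)
    case (Cons x ms)
    have "(\<forall>m\<in>set ms. m < n) \<longleftrightarrow> (r = 0 \<or> hd ms < n)"
      if "sorted_wrt (>) ms" "length ms = r"
      using that by (cases ms) auto
    then show ?thesis by (auto simp: Cons decreasing_tuples_def)
  qed (auto simp: decreasing_tuples_def)
  then show ?thesis by (auto simp: decreasing_tuples_0)
qed

lemma finite_decreasing_tuples_head: "finite {ns \<in> decreasing_tuples r. hd ns = n}"
proof (induction r arbitrary: n)
  case (Suc r)
  then show ?case unfolding decreasing_tuples_Suc_head by auto
qed (simp add: decreasing_tuples_0)

lemma sum_decreasing_tuples_head:
  assumes "as \<noteq> []"
  shows "(\<Sum>ns | ns \<in> decreasing_tuples (length as) \<and> hd ns = n.
           \<Prod>i<length as. inverse (real (ns ! i) ^ (as ! i))) = nested_coeff as n"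
  using assms
proof (induction as arbitrary: n)
  case (Cons a as)
  show ?case
  proof (cases "n = 0")
    case True
    then have "{ns \<in> decreasing_tuples (length (a # as)). hd ns = n} = {}"
      using decreasing_tuples_Suc_head[of "length as" n] by simp
    then show ?thesis using True by (simp only:) simp
  next
    case n: False
    define T where "T = (if as = [] then {[]}
      else (\<Union>m<n. {ns \<in> decreasing_tuples (length as). hd ns = m}))"
    have "{ns \<in> decreasing_tuples (length (a # as)). hd ns = n} = (#) n ` T"
      using n decreasing_tuples_Suc_head[of "length as" n] by (auto simp: T_def)
    then have "(\<Sum>ns | ns \<in> decreasing_tuples (length (a # as)) \<and> hd ns = n.
        \<Prod>i<length (a # as). inverse (real (ns ! i) ^ ((a # as) ! i))) =
        (\<Sum>ns\<in>T. \<Prod>i<length (a # as). inverse (real ((n # ns) ! i) ^ ((a # as) ! i)))"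
      by (simp add: sum.reindex)
    also have "\<dots> = inverse (real n ^ a) *
        (\<Sum>ns\<in>T. \<Prod>i<length as. inverse (real (ns ! i) ^ (as ! i)))"
      by (simp add: prod.lessThan_Suc_shift sum_distrib_left del: prod.lessThan_Suc)
    also have "(\<Sum>ns\<in>T. \<Prod>i<length as. inverse (real (ns ! i) ^ (as ! i))) =
        (\<Sum>m<n. nested_coeff as m)"
    proof (cases "as = []")
      case True
      then show ?thesis using n by (simp add: T_def of_bool_def sum.delta)
    next
      case False
      then have "(\<Sum>ns\<in>T. \<Prod>i<length as. inverse (real (ns ! i) ^ (as ! i))) =
        (\<Sum>m<n. \<Sum>ns | ns \<in> decreasing_tuples (length as) \<and> hd ns = m.
           \<Prod>i<length as. inverse (real (ns ! i) ^ (as ! i)))"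
        unfolding T_def if_not_P[OF False]
        by (intro sum.UNION_disjoint) (auto intro: finite_decreasing_tuples_head)
      then show ?thesis using Cons.IH[OF False] by simp
    qed
    finally show ?thesis by simp
  qed
qed simp

text \<open>The unordered family is grouped by the head n: each fibre is finite and sums to one
  coefficient, and nonnegativity of the terms makes the regrouping legitimate.\<close>

lemma \<sigma>_eq_eval_fps:
  assumes "as \<noteq> []"
  shows "\<sigma> as = eval_fps (apery_fps as) 1"
proof -
  define f where "f ns = inverse (real ((2 * hd ns) choose hd ns)) *
      (\<Prod>i<length as. inverse (real (ns ! i) ^ (as ! i)))" for ns
  define B where "B n = {ns \<in> decreasing_tuples (length as). hd ns = n}" for n
  have nonneg: "0 \<le> f ns" for ns
    unfolding f_def by (intro mult_nonneg_nonneg prod_nonneg) auto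
  have inner: "((\<lambda>ns. f ns) has_sum fps_nth (apery_fps as) n) (B n)" for n
  proof -
    have "sum f (B n) = inverse (real ((2 * n) choose n)) *
        (\<Sum>ns\<in>B n. \<Prod>i<length as. inverse (real (ns ! i) ^ (as ! i)))"
      unfolding sum_distrib_left by (intro sum.cong) (auto simp: f_def B_def)
    also have "\<dots> = fps_nth (apery_fps as) n"
      using sum_decreasing_tuples_head[OF assms, of n] by (simp add: B_def field_simps)
    finally show ?thesis
      using has_sum_finite[of "B n" f] finite_decreasing_tuples_head by (simp add: B_def)
  qed
  have "fps_nth (apery_fps as) sums eval_fps (apery_fps as) 1"
    using sums_eval_fps[of "1::real" "apery_fps as"]
      order.strict_trans2[OF _ fps_conv_radius_apery[of as], of 1]
    by (simp del: apery_fps_nth add: one_ereal_def)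
  then have outer: "(fps_nth (apery_fps as) has_sum eval_fps (apery_fps as) 1) UNIV"
    by (rule sums_nonneg_imp_has_sum) (simp add: nested_coeff_nonneg)
  have "((\<lambda>(n, ns). f ns) has_sum eval_fps (apery_fps as) 1) (Sigma UNIV B)"
  proof (rule has_sum_SigmaI)
    show "(\<lambda>(n, ns). f ns) summable_on Sigma UNIV B"
      using inner outer nonneg
      by (intro summable_on_SigmaI[where g = "fps_nth (apery_fps as)"])
        (auto simp: summable_on_def)
  qed (use inner outer in auto)
  moreover have "bij_betw snd (Sigma UNIV B) (decreasing_tuples (length as))"
    by (rule bij_betwI[where g = "\<lambda>ns. (hd ns, ns)"]) (auto simp: B_def)
  ultimately have "(f has_sum eval_fps (apery_fps as) 1) (decreasing_tuples (length as))"
    using has_sum_reindex_bij_betw[of snd "Sigma UNIV B" "decreasing_tuples (length as)" f]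
    by (simp add: case_prod_unfold)
  then show ?thesis
    unfolding \<sigma>_def f_def by (rule infsumI)
qed

section \<open>Differential equations and integral representations\<close>

lemma central_binomial_Suc: "(n + 1) * ((2 * (n + 1)) choose (n + 1)) = 2 * (2 * n + 1) * ((2 * n) choose n)"
proof -
  have "(2 * (n + 1)) choose (n + 1) = 2 * (Suc (2 * n) choose Suc n)"
    using binomial_symmetric[of n "Suc (2 * n)"] by simp
  moreover have "(n + 1) * (Suc (2 * n) choose Suc n) = (2 * n + 1) * ((2 * n) choose n)"
    using Suc_times_binomial[of n "2 * n"] by simp
  ultimately show ?thesis by (metis mult.assoc mult.left_commute)
qed

lemma nested_coeff_2:
  "real n ^ 2 * nested_coeff (2 # as) n = (\<Sum>m<n. nested_coeff as m)"
  by (cases "n = 0") auto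

text \<open>The operator on the left is the second derivative in s, written in z = 2 - 2 cos s: one
  has z'' = 2 cos s = 2 - z and z'^2 = 4 sin(s)^2 = 4z - z^2. On coefficients,
  \<open>central_binomial_Suc\<close> brings both terms over the same binomial, and the difference
  of two consecutive inner sums of \<open>nested_coeff\<close> is a single term.\<close>

lemma apery_fps_2:
  fixes as :: "nat list"
  defines "F \<equiv> apery_fps (2 # as)"
  shows "fps_const 2 * fps_deriv F - fps_X * fps_deriv F + fps_const 4 * (fps_X * fps_deriv (fps_deriv F))
           - fps_X * (fps_X * fps_deriv (fps_deriv F)) = apery_fps as" (is "?L = _")
proof (rule fps_ext)
  fix n
  define c where "c = fps_nth F"
  have "fps_nth ?L n = (real n + 1) * (4 * real n + 2) * c (n + 1) - real n ^ 2 * c n"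
  proof (cases n)
    case (Suc k)
    then show ?thesis
      by (cases k) (simp_all add: c_def algebra_simps power2_eq_square del: apery_fps_nth nested_coeff.simps)
  qed (simp add: c_def)
  also have "(real n + 1) * (4 * real n + 2) * c (n + 1) =
      (real (n + 1)) ^ 2 * nested_coeff (2 # as) (n + 1) / real ((2 * n) choose n)"
  proof -
    have rec: "real (n + 1) * real ((2 * (n + 1)) choose (n + 1)) = 2 * (2 * real n + 1) * real ((2 * n) choose n)"
      using arg_cong[OF central_binomial_Suc[of n], of real]
      by (simp only: of_nat_mult of_nat_add of_nat_numeral of_nat_1)
    have fraction: "(real n + 1) * (4 * real n + 2) * (x / A) = (real (n + 1)) ^ 2 * x / B"
      if "real (n + 1) * A = 2 * (2 * real n + 1) * B" "A > 0" "B > 0" for x A B :: real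
    proof -
      have "(real n + 1) * (4 * real n + 2) * x * B = (real n + 1) * x * (2 * (2 * real n + 1) * B)"
        by (simp add: algebra_simps)
      also have "\<dots> = (real (n + 1)) ^ 2 * x * A"
        unfolding that(1) [symmetric] by (simp add: power2_eq_square)
      finally show ?thesis using that(2,3) by (simp add: divide_simps)
    qed
    show ?thesis
      unfolding c_def F_def apery_fps_nth by (rule fraction[OF rec]) (simp_all only: of_nat_0_less_iff zero_less_binomial_iff, simp_all)
  qed
  also have "real n ^ 2 * c n = real n ^ 2 * nested_coeff (2 # as) n / real ((2 * n) choose n)"
    by (simp add: c_def F_def)
  finally show "fps_nth ?L n = fps_nth (apery_fps as) n"
    unfolding nested_coeff_2 by (simp add: diff_divide_distrib [symmetric] del: nested_coeff.simps)
qed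

lemma fps_X_mult_deriv_nth: "fps_nth (fps_X * fps_deriv f) n = of_nat n * fps_nth f n"
  by (cases n) auto

text \<open>The operator z d/dz multiplies the n-th coefficient by n, which lowers the first
  exponent by one.\<close>

lemma apery_fps_3: "fps_X * fps_deriv (apery_fps (3 # as)) = apery_fps (2 # as)"
proof (rule fps_ext)
  fix n show "fps_nth (fps_X * fps_deriv (apery_fps (3 # as))) n = fps_nth (apery_fps (2 # as)) n"
    unfolding fps_X_mult_deriv_nth
    by (cases "n = 0") (auto simp: power2_eq_square power3_eq_cube)
qed

lemma apery_fps_1: "fps_X * fps_deriv (apery_fps (2 # as)) = apery_fps (1 # as)"
proof (rule fps_ext)
  fix n show "fps_nth (fps_X * fps_deriv (apery_fps (2 # as))) n = fps_nth (apery_fps (1 # as)) n"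
    unfolding fps_X_mult_deriv_nth
    by (cases "n = 0") (auto simp: power2_eq_square)
qed

section \<open>The series as functions of the angle s\<close>

definition apery_fun :: "nat list \<Rightarrow> real \<Rightarrow> real" where
  "apery_fun as s = eval_fps (apery_fps as) (2 - 2 * cos s)"

definition apery_fun' :: "nat list \<Rightarrow> real \<Rightarrow> real" where
  "apery_fun' as s = eval_fps (fps_deriv (apery_fps as)) (2 - 2 * cos s) * (2 * sin s)"

lemma eval_fps_X_mult:
  assumes "ereal \<bar>z\<bar> < fps_conv_radius f"
  shows "eval_fps (fps_X * f) z = z * eval_fps f (z :: real)"
  using assms by (subst eval_fps_mult) auto

lemma eval_fps_const_mult:
  assumes "ereal \<bar>z\<bar> < fps_conv_radius f"
  shows "eval_fps (fps_const c * f) z = c * eval_fps f (z :: real)"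
  using assms by (subst eval_fps_mult) auto

lemma two_minus_2_cos: "2 - 2 * cos s = 4 * sin (s / 2) ^ 2" for s :: real
  using cos_double[of "s / 2"] by (simp add: cos_squared_eq)

context
  fixes s :: real
  assumes s: "s \<in> {- pi / 2 <..< pi / 2}"
begin

lemma conv_radius_apery_point:
  "ereal \<bar>2 - 2 * cos s\<bar> < fps_conv_radius (apery_fps as)"
  "ereal \<bar>2 - 2 * cos s\<bar> < fps_conv_radius (fps_deriv (apery_fps as))"
  "ereal \<bar>2 - 2 * cos s\<bar> < fps_conv_radius (fps_deriv (fps_deriv (apery_fps as)))"
proof -
  have "cos s > 0" using s by (intro cos_gt_zero_pi) auto
  moreover have "cos s \<le> 1" by simp
  ultimately have "\<bar>2 - 2 * cos s\<bar> < 2" by linarith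
  then have "ereal \<bar>2 - 2 * cos s\<bar> < 2" by simp
  then show "ereal \<bar>2 - 2 * cos s\<bar> < fps_conv_radius (apery_fps as)"
    using fps_conv_radius_apery by (rule order.strict_trans2)
  then show "ereal \<bar>2 - 2 * cos s\<bar> < fps_conv_radius (fps_deriv (apery_fps as))"
    using fps_conv_radius_deriv by (rule order.strict_trans2)
  then show "ereal \<bar>2 - 2 * cos s\<bar> < fps_conv_radius (fps_deriv (fps_deriv (apery_fps as)))"
    using fps_conv_radius_deriv by (rule order.strict_trans2)
qed

lemma apery_fun_deriv: "(apery_fun as has_real_derivative apery_fun' as s) (at s)"
  unfolding apery_fun_def [abs_def] apery_fun'_def
  using conv_radius_apery_point(1)[of as]
  by (intro DERIV_chain2[OF has_field_derivative_eval_fps]) (auto intro!: derivative_eq_intros)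

lemma apery_fun'_deriv: "(apery_fun' (2 # as) has_real_derivative apery_fun as s) (at s)"
proof -
  define z where "z = 2 - 2 * cos s"
  define F where "F = apery_fps (2 # as)"
  have r: "ereal \<bar>z\<bar> < fps_conv_radius (fps_deriv F)"
      "ereal \<bar>z\<bar> < fps_conv_radius (fps_deriv (fps_deriv F))"
    unfolding F_def z_def by (rule conv_radius_apery_point)+
  have rm: "ereal \<bar>z\<bar> < fps_conv_radius (g * f)"
    if "ereal \<bar>z\<bar> < fps_conv_radius f" "fps_conv_radius g = \<infinity>" for f g :: "real fps"
    using that fps_conv_radius_mult[of g f] by (auto intro: order.strict_trans2)
  have ra: "ereal \<bar>z\<bar> < fps_conv_radius (f + g)" "ereal \<bar>z\<bar> < fps_conv_radius (f - g)"
    if "ereal \<bar>z\<bar> < fps_conv_radius f" "ereal \<bar>z\<bar> < fps_conv_radius g" for f g :: "real fps"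
    using that order.strict_trans2[OF _ fps_conv_radius_add[of f g]]
      order.strict_trans2[OF _ fps_conv_radius_diff[of f g]] by auto
  have "apery_fun as s = eval_fps (fps_const 2 * fps_deriv F - fps_X * fps_deriv F
      + fps_const 4 * (fps_X * fps_deriv (fps_deriv F)) - fps_X * (fps_X * fps_deriv (fps_deriv F))) z"
    unfolding F_def apery_fps_2 by (simp add: apery_fun_def z_def)
  also have "\<dots> = 2 * eval_fps (fps_deriv F) z - z * eval_fps (fps_deriv F) z
      + 4 * (z * eval_fps (fps_deriv (fps_deriv F)) z) - z * (z * eval_fps (fps_deriv (fps_deriv F)) z)"
    by (simp add: eval_fps_add eval_fps_diff eval_fps_X_mult eval_fps_const_mult r rm ra)
  also have "\<dots> = eval_fps (fps_deriv (fps_deriv F)) z * (2 * sin s) * (2 * sin s)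
      + eval_fps (fps_deriv F) z * (2 * cos s)"
  proof -
    have "(2 * sin s) * (2 * sin s) = 4 * z - z * z"
      using sin_cos_squared_add[of s] unfolding z_def power2_eq_square by algebra
    then have "eval_fps (fps_deriv (fps_deriv F)) z * (2 * sin s) * (2 * sin s) =
        eval_fps (fps_deriv (fps_deriv F)) z * (4 * z - z * z)"
      by (metis mult.assoc)
    moreover have cos: "2 * cos s = 2 - z" by (simp add: z_def)
    ultimately show ?thesis unfolding cos by (simp add: algebra_simps)
  qed
  finally have eq: "apery_fun as s = \<dots>" .
  have "((\<lambda>s. eval_fps (fps_deriv F) (2 - 2 * cos s)) has_real_derivative
      eval_fps (fps_deriv (fps_deriv F)) z * (2 * sin s)) (at s)"
    using r(1) unfolding z_def
    by (intro DERIV_chain2[OF has_field_derivative_eval_fps])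
      (auto intro!: derivative_eq_intros)
  then show ?thesis
    unfolding eq apery_fun'_def [abs_def] F_def [symmetric]
    by (auto intro!: derivative_eq_intros simp: z_def)
qed

text \<open>The factor z equals tan(s/2) times dz/ds = 2 sin s, so z d/dz becomes tan(s/2)
  d/ds.\<close>

lemma apery_fun_1: "apery_fun (1 # as) s = tan (s / 2) * apery_fun' (2 # as) s"
proof -
  have "cos (s / 2) > 0" using s by (intro cos_gt_zero_pi) auto
  then have eq: "2 - 2 * cos s = tan (s / 2) * (2 * sin s)"
    using sin_double[of "s / 2"] two_minus_2_cos
    by (simp add: tan_def power2_eq_square)
  have "(2 - 2 * cos s) * y = tan (s / 2) * (y * (2 * sin s))" for y
    by (subst eq) simp
  then show ?thesis
    unfolding apery_fun_def apery_fun'_def apery_fps_1 [symmetric]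
      eval_fps_X_mult[OF conv_radius_apery_point(2)] .
qed

lemma apery_fun'_3: "apery_fun' (3 # as) s = cot (s / 2) * apery_fun (2 # as) s"
proof -
  \<comment> \<open>At s = 0 this also holds: both sides vanish, division by 0 giving 0.\<close>
  have eq: "2 * sin s = cot (s / 2) * (2 - 2 * cos s)"
    using sin_double[of "s / 2"] two_minus_2_cos
    by (simp add: cot_def power2_eq_square)
  have "y * (2 * sin s) = cot (s / 2) * ((2 - 2 * cos s) * y)" for y
    by (subst eq) simp
  then show ?thesis
    unfolding apery_fun_def apery_fun'_def apery_fps_3 [symmetric]
      eval_fps_X_mult[OF conv_radius_apery_point(2)] .
qed

end

lemma apery_fun_0 [simp]: "as \<noteq> [] \<Longrightarrow> apery_fun as 0 = 0"
  by (cases as) (simp_all add: apery_fun_def eval_fps_at_0)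

lemma apery_fun'_0 [simp]: "apery_fun' as 0 = 0"
  by (simp add: apery_fun'_def)

lemma has_real_derivative_unique:
  fixes f g :: "real \<Rightarrow> real"
  assumes "convex S" "a \<in> S" "s \<in> S" "f a = g a"
    and "\<And>x. x \<in> S \<Longrightarrow> (f has_real_derivative h x) (at x)"
    and "\<And>x. x \<in> S \<Longrightarrow> (g has_real_derivative h x) (at x)"
  shows "f s = g s"
proof -
  have "((\<lambda>x. f x - g x) has_field_derivative 0) (at x within S)" if "x \<in> S" for x
    using DERIV_diff[OF assms(5,6)[OF that]] by (simp add: has_field_derivative_at_within)
  then obtain c where "\<forall>x\<in>S. f x - g x = c"
    using has_field_derivative_zero_constant[OF assms(1)] by metis
  then have "f s - g s = f a - g a" using assms(2,3) by metis
  then show ?thesis using assms(4) by simp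
qed

lemma DERIV_divided_power:
  "((\<lambda>x. x ^ Suc n / fact (Suc n)) has_real_derivative x ^ n / fact n) (at x)"
  using DERIV_cdivide[OF DERIV_pow[of "Suc n" x], of "fact (Suc n)"] by simp

lemma apery_fun'_twos_step:
  assumes "s \<in> {- pi / 2 <..< pi / 2}"
    and "\<And>s. s \<in> {- pi / 2 <..< pi / 2} \<Longrightarrow> apery_fun (replicate j 2) s = s ^ (2 * j) / fact (2 * j)"
  shows "apery_fun' (replicate (Suc j) 2) s = s ^ Suc (2 * j) / fact (Suc (2 * j))"
proof (rule has_real_derivative_unique[where S = "{- pi / 2 <..< pi / 2}" and a = 0
      and g = "\<lambda>s. s ^ Suc (2 * j) / fact (Suc (2 * j))" and h = "\<lambda>x. x ^ (2 * j) / fact (2 * j)"])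
  fix x :: real assume x: "x \<in> {- pi / 2 <..< pi / 2}"
  show "(apery_fun' (replicate (Suc j) 2) has_real_derivative x ^ (2 * j) / fact (2 * j)) (at x)"
    using apery_fun'_deriv[OF x, of "replicate j 2"] assms(2)[OF x] by simp
qed (use assms(1) DERIV_divided_power in \<open>auto simp del: fact_Suc power_Suc\<close>)

text \<open>Each leading 2 means integrating twice from 0 with zero initial values, starting from
  the constant 1. For j = 1 this is the classical power series of arcsin^2, evaluated at
  sin(s/2).\<close>

lemma apery_fun_twos:
  assumes "s \<in> {- pi / 2 <..< pi / 2}"
  shows "apery_fun (replicate j 2) s = s ^ (2 * j) / fact (2 * j)"
  using assms
proof (induction j arbitrary: s)
  case 0
  have "apery_fps [] = 1" by (rule fps_ext) simp
  then show ?case by (simp add: apery_fun_def)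
next
  case (Suc j)
  have "apery_fun (replicate (Suc j) 2) s = s ^ Suc (Suc (2 * j)) / fact (Suc (Suc (2 * j)))"
  proof (rule has_real_derivative_unique[where S = "{- pi / 2 <..< pi / 2}" and a = 0
        and g = "\<lambda>s. s ^ Suc (Suc (2 * j)) / fact (Suc (Suc (2 * j)))"
        and h = "\<lambda>x. x ^ Suc (2 * j) / fact (Suc (2 * j))"])
    fix x :: real assume x: "x \<in> {- pi / 2 <..< pi / 2}"
    show "(apery_fun (replicate (Suc j) 2) has_real_derivative
        x ^ Suc (2 * j) / fact (Suc (2 * j))) (at x)"
      using apery_fun_deriv[OF x, of "replicate (Suc j) 2"] apery_fun'_twos_step[OF x Suc.IH]
      by simp
  qed (use Suc.prems DERIV_divided_power in \<open>auto simp del: fact_Suc power_Suc\<close>)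
  then show ?case by simp
qed

lemma apery_fun'_twos:
  assumes "s \<in> {- pi / 2 <..< pi / 2}"
  shows "apery_fun' (replicate (Suc j) 2) s = s ^ (2 * j + 1) / fact (2 * j + 1)"
  using apery_fun'_twos_step[OF assms apery_fun_twos] by simp

section \<open>Taylor's formula at the origin with integral remainder\<close>

lemma \<sigma>_eq_apery_fun: "as \<noteq> [] \<Longrightarrow> \<sigma> as = apery_fun as (pi / 3)"
  by (simp add: \<sigma>_eq_eval_fps apery_fun_def cos_60)

lemma third_pi_interval: "t \<in> {0..pi / 3} \<Longrightarrow> t \<in> {- pi / 2 <..< pi / 2}"
  using pi_gt_zero unfolding atLeastAtMost_iff greaterThanLessThan_iff by linarith

text \<open>The m-th derivative of \<open>apery_fun (replicate i 2 @ as)\<close> as long as m <= 2 i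
  + 1: every second derivative strips one leading 2. For larger m the truncated subtraction breaks
  this reading, whence the bound on \<open>p\<close> below.\<close>

definition apery_higher_deriv :: "nat list \<Rightarrow> nat \<Rightarrow> nat \<Rightarrow> real \<Rightarrow> real" where
  "apery_higher_deriv as i m =
     (if even m then apery_fun else apery_fun') (replicate (i - m div 2) 2 @ as)"

lemma \<sigma>_twos_append_has_integral:
  assumes "as \<noteq> []" "0 < p" "p \<le> 2 * i + 1"
  shows "((\<lambda>t. (pi / 3 - t) ^ (p - 1) / fact (p - 1) * apery_higher_deriv as i p t)
           has_integral \<sigma> (replicate i 2 @ as)) {0..pi / 3}"
proof -
  have "((\<lambda>t. ((pi / 3 - t) ^ (p - 1) / fact (p - 1)) *\<^sub>R apery_higher_deriv as i p t) has_integral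
      apery_fun (replicate i 2 @ as) (pi / 3) -
      (\<Sum>m<p. ((pi / 3 - 0) ^ m / fact m) *\<^sub>R apery_higher_deriv as i m 0)) {0..pi / 3}"
  proof (rule Taylor_has_integral)
    fix m t assume m: "m < p" and "0 \<le> t" "t \<le> pi / 3"
    then have t: "t \<in> {- pi / 2 <..< pi / 2}" by (intro third_pi_interval) auto
    have "(apery_higher_deriv as i m has_real_derivative apery_higher_deriv as i (Suc m) t) (at t)"
    proof (cases "even m")
      case True
      then show ?thesis using apery_fun_deriv[OF t] by (simp add: apery_higher_deriv_def)
    next
      case False
      then obtain h where h: "m = 2 * h + 1" by (elim oddE)
      then have "i - h = Suc (i - Suc h)" using m assms(3) by simp
      then show ?thesis using False h apery_fun'_deriv[OF t, of "replicate (i - Suc h) 2 @ as"]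
        by (simp add: apery_higher_deriv_def)
    qed
    then show "(apery_higher_deriv as i m has_vector_derivative apery_higher_deriv as i (Suc m) t)
        (at t within {0..pi / 3})"
      by (simp add: has_real_derivative_iff_has_vector_derivative has_vector_derivative_at_within)
  qed (use assms in \<open>auto simp: apery_higher_deriv_def\<close>)
  \<comment> \<open>All functions involved vanish at 0, so the Taylor polynomial disappears and the
    remainder is the whole value.\<close>
  moreover have "apery_higher_deriv as i m 0 = 0" for m
    using assms(1) by (simp add: apery_higher_deriv_def)
  ultimately show ?thesis using assms(1) by (simp add: \<sigma>_eq_apery_fun)
qed

lemma \<sigma>_232_has_integral:
  "((\<lambda>t. (pi / 3 - t) ^ (2 * i) / fact (2 * i) * (t ^ (2 * j + 2) / fact (2 * j + 2)) * cot (t / 2))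
     has_integral \<sigma> (replicate i 2 @ [3] @ replicate j 2)) {0..pi / 3}"
proof -
  have "apery_higher_deriv (3 # replicate j 2) i (2 * i + 1) t =
      t ^ (2 * j + 2) / fact (2 * j + 2) * cot (t / 2)" if "t \<in> {0..pi / 3}" for t
  proof -
    have t: "t \<in> {- pi / 2 <..< pi / 2}" using that by (rule third_pi_interval)
    show ?thesis using apery_fun'_3[OF t, of "replicate j 2"] apery_fun_twos[OF t, of "Suc j"]
      by (simp add: apery_higher_deriv_def)
  qed
  note deriv = this
  have "((\<lambda>t. (pi / 3 - t) ^ (2 * i) / fact (2 * i) *
      apery_higher_deriv (3 # replicate j 2) i (2 * i + 1) t)
      has_integral \<sigma> (replicate i 2 @ 3 # replicate j 2)) {0..pi / 3}"
    using \<sigma>_twos_append_has_integral[of "3 # replicate j 2" "2 * i + 1" i] by simp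
  then show ?thesis
    unfolding append_Cons append_Nil
    by (rule has_integral_eq[rotated]) (simp only: deriv mult.assoc)
qed

text \<open>The expansion stops at order 2i, one earlier than for the entry 3, because the tangent
  already appears in the function with leading 1 and not only in its derivative. Positivity of this
  order is the admissibility of the composition.\<close>

lemma \<sigma>_212_has_integral:
  assumes "0 < i"
  shows "((\<lambda>t. (pi / 3 - t) ^ (2 * i - 1) / fact (2 * i - 1) * (t ^ (2 * j + 1) / fact (2 * j + 1)) * tan (t / 2))
     has_integral \<sigma> (replicate i 2 @ [1] @ replicate j 2)) {0..pi / 3}"
proof -
  have "apery_higher_deriv (1 # replicate j 2) i (2 * i) t =
      t ^ (2 * j + 1) / fact (2 * j + 1) * tan (t / 2)" if "t \<in> {0..pi / 3}" for t
  proof -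
    have t: "t \<in> {- pi / 2 <..< pi / 2}" using that by (rule third_pi_interval)
    show ?thesis using apery_fun_1[OF t, of "replicate j 2"] apery_fun'_twos[OF t, of "j"]
      by (simp add: apery_higher_deriv_def)
  qed
  note deriv = this
  have "((\<lambda>t. (pi / 3 - t) ^ (2 * i - 1) / fact (2 * i - 1) *
      apery_higher_deriv (1 # replicate j 2) i (2 * i) t)
      has_integral \<sigma> (replicate i 2 @ 1 # replicate j 2)) {0..pi / 3}"
    using assms by (intro \<sigma>_twos_append_has_integral) auto
  then show ?thesis
    unfolding append_Cons append_Nil
    by (rule has_integral_eq[rotated]) (simp only: deriv mult.assoc)
qed

section \<open>Sine series of the cotangent kernel\<close>

text \<open>One integration by parts against sin(w(t + c))/w gains the factor 1/w.\<close>

lemma polynomial_cos_integral_bound: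
  fixes a b c :: real
  assumes "real_polynomial_function p" "a \<le> b"
  obtains K where "\<And>w. 0 < w \<Longrightarrow> \<bar>integral {a..b} (\<lambda>t. p t * cos (w * (t + c)))\<bar> \<le> K / w"
proof -
  obtain p' where p': "real_polynomial_function p'" "\<And>x. (p has_real_derivative p' x) (at x)"
    using has_real_derivative_polynomial_function[OF assms(1)] by blast
  have cont: "continuous_on A p" "continuous_on A p'" for A
    using assms(1) p'(1) continuous_on_polymonial_function
    by (auto simp: real_polynomial_function_eq)
  have "bounded (p' ` {a..b})"
    using compact_continuous_image[OF cont(2) compact_Icc] by (rule compact_imp_bounded)
  then obtain B where "\<forall>x\<in>p' ` {a..b}. \<bar>x\<bar> \<le> B" by (auto simp: bounded_iff)
  then have B: "\<bar>p' t\<bar> \<le> B" if "t \<in> {a..b}" for t using that by blast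
  have "\<bar>integral {a..b} (\<lambda>t. p t * cos (w * (t + c)))\<bar> \<le> (\<bar>p b\<bar> + \<bar>p a\<bar> + B * (b - a)) / w"
    if w: "0 < w" for w
  proof -
    define F where "F t = p t * sin (w * (t + c))" for t
    have "((\<lambda>t. p' t * sin (w * (t + c)) + w * (p t * cos (w * (t + c)))) has_integral F b - F a) {a..b}"
    proof (rule fundamental_theorem_of_calculus[OF assms(2)])
      fix t
      have "((\<lambda>t. sin (w * (t + c))) has_real_derivative w * cos (w * (t + c))) (at t)"
        by (auto intro!: derivative_eq_intros)
      from DERIV_mult[OF p'(2) this]
      have "(F has_real_derivative p' t * sin (w * (t + c)) + w * (p t * cos (w * (t + c)))) (at t)"
        by (simp add: F_def [abs_def] algebra_simps)
      then show "(F has_vector_derivative p' t * sin (w * (t + c)) + w * (p t * cos (w * (t + c))))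
          (at t within {a..b})"
        by (simp add: has_real_derivative_iff_has_vector_derivative has_vector_derivative_at_within)
    qed
    moreover have i1: "((\<lambda>t. p' t * sin (w * (t + c))) has_integral
        integral {a..b} (\<lambda>t. p' t * sin (w * (t + c)))) {a..b}"
      by (intro integrable_integral integrable_continuous_real continuous_intros cont)
    ultimately have "((\<lambda>t. w * (p t * cos (w * (t + c)))) has_integral
        F b - F a - integral {a..b} (\<lambda>t. p' t * sin (w * (t + c)))) {a..b}"
      using has_integral_diff[of _ "F b - F a" "{a..b}"] by fastforce
    then have "w * integral {a..b} (\<lambda>t. p t * cos (w * (t + c))) =
        F b - F a - integral {a..b} (\<lambda>t. p' t * sin (w * (t + c)))"
      by (metis integral_mult_right integral_unique)
    moreover have "\<bar>F b\<bar> \<le> \<bar>p b\<bar>" "\<bar>F a\<bar> \<le> \<bar>p a\<bar>"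
      unfolding F_def abs_mult by (intro mult_left_le abs_sin_le_one abs_ge_zero)+
    moreover have "norm (integral {a..b} (\<lambda>t. p' t * sin (w * (t + c)))) \<le> B * (b - a)"
    proof (rule integral_bound[OF assms(2)])
      show "continuous_on {a..b} (\<lambda>t. p' t * sin (w * (t + c)))"
        by (intro continuous_intros cont)
      fix t assume "t \<in> {a..b}"
      then have "\<bar>p' t\<bar> * \<bar>sin (w * (t + c))\<bar> \<le> B * 1"
        using B[of t] by (intro mult_mono) auto
      then show "norm (p' t * sin (w * (t + c))) \<le> B" by (simp add: abs_mult)
    qed
    ultimately have "\<bar>w * integral {a..b} (\<lambda>t. p t * cos (w * (t + c)))\<bar>
        \<le> \<bar>p b\<bar> + \<bar>p a\<bar> + B * (b - a)" unfolding real_norm_def by linarith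
    then show ?thesis using w by (simp add: abs_mult field_simps)
  qed
  then show ?thesis by (rule that)
qed

text \<open>Polynomials approximate \<open>g\<close> uniformly by Stone-Weierstrass; the
  approximation error contributes at most e/2 for every frequency, and the polynomial part decays
  like 1/w.\<close>

lemma Riemann_Lebesgue_cos:
  fixes a b c :: real and w :: "nat \<Rightarrow> real"
  assumes "continuous_on {a..b} g" "a \<le> b" "filterlim w at_top sequentially"
  shows "(\<lambda>N. integral {a..b} (\<lambda>t. g t * cos (w N * (t + c)))) \<longlonglongrightarrow> 0"
proof (rule LIMSEQ_I)
  fix e :: real assume e: "0 < e"
  define d where "d = e / (2 * (b - a + 1))"
  have d: "0 < d" using e assms(2) by (simp add: d_def)
  have db: "d * (b - a) \<le> e / 2"
    using e assms(2) by (simp add: d_def field_simps)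
  obtain p where p: "real_polynomial_function p" "\<And>t. t \<in> {a..b} \<Longrightarrow> \<bar>g t - p t\<bar> < d"
    using Stone_Weierstrass_real_polynomial_function[OF compact_Icc assms(1) d] by blast
  obtain K where K: "\<And>w. 0 < w \<Longrightarrow> \<bar>integral {a..b} (\<lambda>t. p t * cos (w * (t + c)))\<bar> \<le> K / w"
    using polynomial_cos_integral_bound[OF p(1) assms(2)] by metis
  have cont: "continuous_on {a..b} p"
    using p(1) continuous_on_polymonial_function by (auto simp: real_polynomial_function_eq)
  have "\<forall>\<^sub>F N in sequentially. max 1 (2 * \<bar>K\<bar> / e + 1) \<le> w N"
    using assms(3) unfolding filterlim_at_top by blast
  then have "\<forall>\<^sub>F N in sequentially. norm (integral {a..b} (\<lambda>t. g t * cos (w N * (t + c))) - 0) < e"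
  proof eventually_elim
    case (elim N)
    then have w: "0 < w N" "2 * \<bar>K\<bar> / e < w N" by auto
    have "integral {a..b} (\<lambda>t. g t * cos (w N * (t + c))) =
        integral {a..b} (\<lambda>t. (g t - p t) * cos (w N * (t + c))) +
        integral {a..b} (\<lambda>t. p t * cos (w N * (t + c)))"
      by (subst integral_add [symmetric])
        (auto intro!: integrable_continuous_real continuous_intros cont assms(1) simp: algebra_simps)
    moreover have "norm (integral {a..b} (\<lambda>t. (g t - p t) * cos (w N * (t + c)))) \<le> d * (b - a)"
    proof (rule integral_bound[OF assms(2)])
      fix t assume "t \<in> {a..b}"
      then have "\<bar>g t - p t\<bar> * \<bar>cos (w N * (t + c))\<bar> \<le> d * 1"
        using p(2)[of t] d by (intro mult_mono) auto
      then show "norm ((g t - p t) * cos (w N * (t + c))) \<le> d" by (simp add: abs_mult)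
    qed (intro continuous_intros cont assms(1))
    moreover have "K / w N < e / 2"
    proof -
      have "K \<le> \<bar>K\<bar>" by simp
      also have "2 * \<bar>K\<bar> < e * w N" using w(2) e by (simp add: field_simps)
      then have "\<bar>K\<bar> < e / 2 * w N" by simp
      finally show ?thesis using w(1) by (simp add: field_simps)
    qed
    ultimately show ?case using K[OF w(1)] db unfolding real_norm_def by linarith
  qed
  then show "\<exists>no. \<forall>n\<ge>no. norm (integral {a..b} (\<lambda>t. g t * cos (w n * (t + c))) - 0) < e"
    by (simp add: eventually_sequentially)
qed

lemma conjugate_Dirichlet_kernel:
  assumes "sin (x / 2) \<noteq> 0"
  shows "cot (x / 2) - 2 * (\<Sum>n<N. sin (real (Suc n) * x)) = cos ((real N + 1 / 2) * x) / sin (x / 2)"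
proof (induction N)
  case (Suc N)
  have "cos ((real N + 1 / 2) * x) - cos ((real (Suc N) + 1 / 2) * x) =
      2 * sin (real (Suc N) * x) * sin (x / 2)"
  proof -
    have "((real N + 1 / 2) * x + (real (Suc N) + 1 / 2) * x) / 2 = real (Suc N) * x"
      "((real (Suc N) + 1 / 2) * x - (real N + 1 / 2) * x) / 2 = x / 2"
      by (simp_all add: field_simps)
    then show ?thesis unfolding cos_diff_cos by (simp only:)
  qed
  then have "cos ((real (Suc N) + 1 / 2) * x) / sin (x / 2) =
      cos ((real N + 1 / 2) * x) / sin (x / 2) - 2 * sin (real (Suc N) * x)"
    using assms by (simp add: field_simps)
  then show ?case using Suc by simp
qed (simp add: cot_def)

text \<open>By the conjugate Dirichlet kernel, the error of the N-th partial sum is the integral of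
  the continuous function P / sin((t + c)/2) against cos((N + 1/2)(t + c)), which tends to 0. Where
  the sine vanishes, \<open>zero\<close> makes both integrands 0.\<close>

lemma cot_integral_sine_series:
  assumes "a \<le> b" and P: "continuous_on {a..b} P"
    and g: "continuous_on {a..b} (\<lambda>t. P t / sin ((t + c) / 2))"
    and zero: "\<And>t. t \<in> {a..b} \<Longrightarrow> sin ((t + c) / 2) = 0 \<Longrightarrow> P t = 0"
    and J: "((\<lambda>t. P t * cot ((t + c) / 2)) has_integral J) {a..b}"
  shows "(\<lambda>N. \<Sum>n<N. 2 * integral {a..b} (\<lambda>t. P t * sin (real (Suc n) * (t + c)))) \<longlonglongrightarrow> J"
proof -
  have "(\<Sum>n<N. 2 * integral {a..b} (\<lambda>t. P t * sin (real (Suc n) * (t + c)))) =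
      J - integral {a..b} (\<lambda>t. P t / sin ((t + c) / 2) * cos ((real N + 1 / 2) * (t + c)))" for N
  proof -
    have "((\<lambda>t. \<Sum>n<N. 2 * (P t * sin (real (Suc n) * (t + c)))) has_integral
        (\<Sum>n<N. 2 * integral {a..b} (\<lambda>t. P t * sin (real (Suc n) * (t + c))))) {a..b}"
      by (intro has_integral_sum has_integral_mult_right integrable_integral
          integrable_continuous_real continuous_intros P) auto
    from has_integral_diff[OF J this]
    have "((\<lambda>t. P t / sin ((t + c) / 2) * cos ((real N + 1 / 2) * (t + c))) has_integral
        J - (\<Sum>n<N. 2 * integral {a..b} (\<lambda>t. P t * sin (real (Suc n) * (t + c))))) {a..b}"
    proof (rule has_integral_eq[rotated])
      fix t assume t: "t \<in> {a..b}"
      have "P t * cot ((t + c) / 2) - (\<Sum>n<N. 2 * (P t * sin (real (Suc n) * (t + c)))) =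
          P t * (cot ((t + c) / 2) - 2 * (\<Sum>n<N. sin (real (Suc n) * (t + c))))"
        by (simp add: sum_distrib_left algebra_simps)
      also have "\<dots> = P t / sin ((t + c) / 2) * cos ((real N + 1 / 2) * (t + c))"
      proof (cases "sin ((t + c) / 2) = 0")
        case False
        show ?thesis unfolding conjugate_Dirichlet_kernel[OF False] by simp
      qed (use zero[OF t] in simp)
      finally show "P t * cot ((t + c) / 2) - (\<Sum>n<N. 2 * (P t * sin (real (Suc n) * (t + c)))) = \<dots>" .
    qed
    then show ?thesis by (simp add: integral_unique)
  qed
  moreover have "(\<lambda>N. J - integral {a..b} (\<lambda>t. P t / sin ((t + c) / 2) * cos ((real N + 1 / 2) * (t + c))))
      \<longlonglongrightarrow> J - 0"
    by (intro tendsto_diff tendsto_const Riemann_Lebesgue_cos[OF g assms(1)]) real_asymp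
  ultimately show ?thesis by simp
qed

text \<open>The r-fold primitive of sin(n x) with zero mean; the phase shift by r pi/2 treats the
  four cases of sign and sine or cosine uniformly.\<close>

definition sin_primitive :: "nat \<Rightarrow> nat \<Rightarrow> real \<Rightarrow> real" where
  "sin_primitive r n x = sin (real n * x - real r * pi / 2) / real n ^ r"

lemma sin_primitive_deriv:
  assumes "0 < n"
  shows "((\<lambda>t. sin_primitive (Suc r) n (t + c)) has_real_derivative sin_primitive r n (t + c)) (at t within A)"
proof -
  have "cos (real n * (t + c) - real (Suc r) * pi / 2) = sin (real n * (t + c) - real r * pi / 2)"
    by (simp add: cos_diff sin_diff add_divide_distrib sin_add cos_add algebra_simps)
  then show ?thesis
    unfolding sin_primitive_def [abs_def] using assms
    by (auto intro!: derivative_eq_intros)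
qed

lemma integral_sin_by_parts:
  assumes "0 < n" "a \<le> b"
    and D: "\<And>r t. (D r has_real_derivative D (Suc r) t) (at t)"
    and "\<And>t. D (Suc d) t = 0"
  shows "integral {a..b} (\<lambda>t. D 0 t * sin (real n * (t + c))) =
    (\<Sum>r\<le>d. (- 1) ^ r * (D r b * sin_primitive (Suc r) n (b + c) - D r a * sin_primitive (Suc r) n (a + c)))"
proof -
  define F where "F t = (\<Sum>r\<le>d. (- 1) ^ r * (D r t * sin_primitive (Suc r) n (t + c)))" for t
  have "(F has_real_derivative D 0 t * sin (real n * (t + c))) (at t within {a..b})" for t
  proof -
    have "(F has_real_derivative (\<Sum>r\<le>d. (- 1) ^ r * (D (Suc r) t * sin_primitive (Suc r) n (t + c)
        + sin_primitive r n (t + c) * D r t))) (at t within {a..b})"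
      unfolding F_def [abs_def] using assms(1)
      by (intro DERIV_sum DERIV_cmult DERIV_mult sin_primitive_deriv
          has_field_derivative_at_within[OF D])
    \<comment> \<open>The alternating signs make the sum telescope, for every d. Its last term
      contains \<open>D (Suc d)\<close>, which is 0 for the given d.\<close>
    also have "(\<Sum>r\<le>d. (- 1) ^ r * (D (Suc r) t * sin_primitive (Suc r) n (t + c)
        + sin_primitive r n (t + c) * D r t)) =
        D 0 t * sin_primitive 0 n (t + c) - (- 1) ^ Suc d * D (Suc d) t * sin_primitive (Suc d) n (t + c)"
      for d by (induction d) (simp_all add: algebra_simps)
    finally show ?thesis using assms(4) by (simp add: sin_primitive_def)
  qed
  then have "((\<lambda>t. D 0 t * sin (real n * (t + c))) has_integral F b - F a) {a..b}"
    using assms(2) by (intro fundamental_theorem_of_calculus)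
      (auto simp flip: has_real_derivative_iff_has_vector_derivative)
  then show ?thesis
    by (simp add: integral_unique F_def sum_subtractf right_diff_distrib)
qed

text \<open>The \<open>k\<close>-th derivative of \<open>x ^ a / fact a\<close>.\<close>

definition divided_power :: "nat \<Rightarrow> nat \<Rightarrow> real \<Rightarrow> real" where
  "divided_power a k x = (if k \<le> a then x ^ (a - k) / fact (a - k) else 0)"

lemma divided_power_deriv: "(divided_power a k has_real_derivative divided_power a (Suc k) x) (at x)"
proof (cases "k < a")
  case True
  then obtain n where n: "a - k = Suc n" by (metis Suc_diff_Suc)
  then have "a - Suc k = n" by simp
  then show ?thesis
    using True n DERIV_cdivide[OF DERIV_pow[of "Suc n" x], of "fact (Suc n)"]
    by (simp add: divided_power_def [abs_def])
next
  case False
  then show ?thesis by (cases "k = a") (auto simp: divided_power_def [abs_def])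
qed

lemma divided_power_0: "divided_power a k 0 = of_bool (k = a)"
  by (auto simp: divided_power_def power_0_left)

text \<open>By Leibniz' rule, \<open>beta_deriv u a b r\<close> is the \<open>r\<close>-th derivative of
  \<open>(u - t) ^ a / fact a * t ^ b / fact b\<close>.\<close>

definition beta_deriv :: "real \<Rightarrow> nat \<Rightarrow> nat \<Rightarrow> nat \<Rightarrow> real \<Rightarrow> real" where
  "beta_deriv u a b r t =
     (\<Sum>k\<le>r. real (r choose k) * (- 1) ^ k * divided_power a k (u - t) * divided_power b (r - k) t)"

lemma beta_deriv_deriv: "(beta_deriv u a b r has_real_derivative beta_deriv u a b (Suc r) t) (at t)"
proof -
  define A where "A k = (- 1) ^ k * divided_power a k (u - t)" for k
  define B where "B k = divided_power b k t" for k
  have dA: "((\<lambda>t. (- 1) ^ k * divided_power a k (u - t)) has_real_derivative A (Suc k)) (at t)" for k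
  proof -
    have "((\<lambda>t. divided_power a k (u - t)) has_real_derivative divided_power a (Suc k) (u - t) * (- 1)) (at t)"
      by (rule DERIV_chain2[OF divided_power_deriv]) (auto intro!: derivative_eq_intros)
    from DERIV_cmult[OF this, of "(- 1) ^ k"] show ?thesis by (simp add: A_def)
  qed
  have dB: "((\<lambda>t. divided_power b k t) has_real_derivative B (Suc k)) (at t)" for k
    unfolding B_def by (rule divided_power_deriv)
  have "((\<lambda>t. \<Sum>k\<le>r. real (r choose k) * (((- 1) ^ k * divided_power a k (u - t)) * divided_power b (r - k) t))
     has_real_derivative (\<Sum>k\<le>r. real (r choose k) * (A (Suc k) * B (r - k) + B (Suc (r - k)) * A k))) (at t)"
    using DERIV_mult[OF dA dB] unfolding A_def B_def by (intro DERIV_sum DERIV_cmult)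
  moreover have "(\<Sum>k\<le>r. real (r choose k) * (A (Suc k) * B (r - k) + B (Suc (r - k)) * A k)) =
      (\<Sum>k\<le>Suc r. real (Suc r choose k) * (A k * B (Suc r - k)))"
  proof -
    \<comment> \<open>Pascal's rule after splitting off k = 0. The second part is then shifted back,
      its top term vanishing because r choose r + 1 is 0.\<close>
    have "(\<Sum>k\<le>Suc r. real (Suc r choose k) * (A k * B (Suc r - k))) =
        (\<Sum>k\<le>r. real (r choose k) * (A (Suc k) * B (r - k))) +
        (A 0 * B (Suc r) + (\<Sum>k\<le>r. real (r choose Suc k) * (A (Suc k) * B (r - k))))"
      by (subst sum.atMost_Suc_shift) (simp add: sum.distrib algebra_simps)
    also have "A 0 * B (Suc r) + (\<Sum>k\<le>r. real (r choose Suc k) * (A (Suc k) * B (r - k))) =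
        (\<Sum>k\<le>Suc r. real (r choose k) * (A k * B (Suc r - k)))"
      by (subst sum.atMost_Suc_shift) simp
    also have "\<dots> = (\<Sum>k\<le>r. real (r choose k) * (B (Suc (r - k)) * A k))"
      by (simp add: Suc_diff_le mult.commute)
    finally show ?thesis by (simp add: sum.distrib algebra_simps)
  qed
  ultimately show ?thesis
    unfolding beta_deriv_def [abs_def] A_def B_def by (simp only: mult.assoc)
qed

lemma beta_deriv_eq_0: "a + b < r \<Longrightarrow> beta_deriv u a b r t = 0"
  unfolding beta_deriv_def by (rule sum.neutral) (auto simp: divided_power_def)

lemma beta_deriv_0: "beta_deriv u a b 0 t = (u - t) ^ a / fact a * (t ^ b / fact b)"
  by (simp add: beta_deriv_def divided_power_def)

text \<open>At t = u only the Leibniz term with k = a survives; for r < a there is none, in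
  accordance with the binomial being 0.\<close>

lemma beta_deriv_at_right:
  assumes "r \<le> a + b"
  shows "beta_deriv u a b r u = (- 1) ^ a * real (r choose a) * u ^ (a + b - r) / fact (a + b - r)"
proof -
  have "beta_deriv u a b r u = (\<Sum>k\<le>r. if k = a then
      real (r choose k) * (- 1) ^ k * divided_power b (r - k) u else 0)"
    unfolding beta_deriv_def by (rule sum.cong) (auto simp: divided_power_0)
  also have "\<dots> = (- 1) ^ a * real (r choose a) * u ^ (a + b - r) / fact (a + b - r)"
    using assms by (auto simp: divided_power_def add.commute)
  finally show ?thesis .
qed

text \<open>At t = 0 only the Leibniz term with r - k = b survives. Its sign has exponent r - b;
  writing r + b keeps the parity and avoids truncated subtraction when r < b, where both sides are
  0.\<close>

lemma beta_deriv_at_left: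
  assumes "r \<le> a + b"
  shows "beta_deriv u a b r 0 = (- 1) ^ (r + b) * real (r choose b) * u ^ (a + b - r) / fact (a + b - r)"
proof -
  have "beta_deriv u a b r 0 = (\<Sum>k\<le>r. if k = r - b \<and> b \<le> r then
      real (r choose k) * (- 1) ^ k * divided_power a k u else 0)"
    unfolding beta_deriv_def by (rule sum.cong) (auto simp: divided_power_0)
  also have "\<dots> = (if b \<le> r then real (r choose (r - b)) * (- 1) ^ (r - b) * divided_power a (r - b) u else 0)"
    by auto
  also have "\<dots> = (- 1) ^ (r + b) * real (r choose b) * u ^ (a + b - r) / fact (a + b - r)"
  proof (cases "b \<le> r")
    case True
    have "a - (r - b) = a + b - r" "r - b \<le> a" using True assms by auto
    moreover have "(- 1 :: real) ^ (r + b) = (- 1) ^ (r - b)" using True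
      by (simp add: minus_one_power_iff)
    ultimately show ?thesis using True
      by (simp add: divided_power_def binomial_symmetric[OF True, symmetric])
  qed simp
  finally show ?thesis .
qed

section \<open>Values of the boundary series\<close>

lemma sums_dvd_indicator:
  fixes f :: "nat \<Rightarrow> real"
  assumes "0 < d" "(\<lambda>n. f (d * Suc n) / real (Suc n) ^ s) sums S"
  shows "(\<lambda>n. of_bool (d dvd Suc n) * f (Suc n) / real (Suc n) ^ s) sums (S / real d ^ s)"
proof -
  \<comment> \<open>The summand for the integer N sits at position N - 1, so multiples of d occupy
    the positions d N - 1.\<close>
  define g where "g n = d * Suc n - 1" for n
  have Suc_g: "Suc (g n) = d * Suc n" for n using assms(1) by (simp add: g_def)
  have "strict_mono g"
  proof (rule strict_monoI)
    fix x y :: nat assume "x < y"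
    then have "d * Suc x < d * Suc y" using assms(1) by simp
    then show "g x < g y" using Suc_g[of x] Suc_g[of y] by linarith
  qed
  moreover have "of_bool (d dvd Suc n) * f (Suc n) / real (Suc n) ^ s = 0" if "n \<notin> range g" for n
  proof -
    have "\<not> d dvd Suc n"
    proof
      assume "d dvd Suc n"
      then obtain c where c: "Suc n = d * c" by (elim dvdE)
      then obtain c' where "c = Suc c'" by (cases c) auto
      then have "n = g c'" using c Suc_g[of c'] by simp
      then show False using that by blast
    qed
    then show ?thesis by simp
  qed
  moreover have "(\<lambda>n. of_bool (d dvd Suc (g n)) * f (Suc (g n)) / real (Suc (g n)) ^ s)
      sums (S / real d ^ s)"
    using sums_divide[OF assms(2), of "real d ^ s"]
    unfolding Suc_g of_nat_mult power_mult_distrib by (simp add: mult.commute del: of_nat_Suc mult_Suc_right)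
  ultimately show ?thesis
    using sums_mono_reindex[of g "\<lambda>n. of_bool (d dvd Suc n) * f (Suc n) / real (Suc n) ^ s"] by simp
qed

lemma zeta_sums:
  assumes "2 \<le> s"
  shows "(\<lambda>n. 1 / real (Suc n) ^ s) sums zeta s"
proof -
  have "summable (\<lambda>n. inverse (real n ^ s))" using assms by (rule inverse_power_summable)
  then have "summable (\<lambda>n. inverse (real (Suc n) ^ s))" by (subst summable_Suc_iff)
  then show ?thesis unfolding zeta_def by (simp add: summable_sums inverse_eq_divide)
qed

lemma L_series_chi3_sums:
  assumes "2 \<le> s"
  shows "(\<lambda>n. chi3 (Suc n) / real (Suc n) ^ s) sums L_series s chi3"
proof -
  have "summable (\<lambda>n. chi3 (Suc n) / real (Suc n) ^ s)"
    by (rule summable_comparison_test'[OF sums_summable[OF zeta_sums[OF assms]], of 0])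
      (auto simp: chi3_def divide_right_mono)
  then show ?thesis unfolding L_series_def by (rule summable_sums)
qed

lemma zeta_dvd_sums:
  assumes "2 \<le> s" "0 < d"
  shows "(\<lambda>n. of_bool (d dvd Suc n) / real (Suc n) ^ s) sums (zeta s / real d ^ s)"
  using sums_dvd_indicator[of d "\<lambda>_. 1" s "zeta s"] zeta_sums[OF assms(1)] assms(2) by simp

text \<open>The cosine depends only on gcd(n, 6), hence is a combination of the indicators of the
  divisors of 6. The sine is odd in n, vanishes at multiples of 3, and differs from a multiple of
  \<open>chi3\<close> by a sign at even n.\<close>

lemma cos_sin_pi_third:
  "cos (real n * (pi / 3)) =
     (1 - 2 * of_bool (2 dvd n) - 3 * of_bool (3 dvd n) + 6 * of_bool (6 dvd n)) / 2"
  "sin (real n * (pi / 3)) = sqrt 3 / 2 * (chi3 n - 2 * (of_bool (2 dvd n) * chi3 n))"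
proof -
  define j where "j = n mod 6"
  define k where "k = n div 6"
  have n: "n = j + 6 * k" by (simp add: j_def k_def)
  have "real n * (pi / 3) = real j * (pi / 3) + 2 * real k * pi"
    by (simp add: n field_simps)
  then have periodic: "cos (real n * (pi / 3)) = cos (real j * (pi / 3))"
    "sin (real n * (pi / 3)) = sin (real j * (pi / 3))"
    by (simp_all only: cos_add sin_add cos_2npi sin_2npi mult_1_right mult_zero_right diff_0_right add_0_right)
  have step: "cos (real (Suc i) * (pi / 3)) = cos (real i * (pi / 3)) / 2 - sqrt 3 / 2 * sin (real i * (pi / 3))"
    "sin (real (Suc i) * (pi / 3)) = sin (real i * (pi / 3)) / 2 + sqrt 3 / 2 * cos (real i * (pi / 3))" for i
  proof -
    have "real (Suc i) * (pi / 3) = real i * (pi / 3) + pi / 3" by (simp add: algebra_simps)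
    then show "cos (real (Suc i) * (pi / 3)) = cos (real i * (pi / 3)) / 2 - sqrt 3 / 2 * sin (real i * (pi / 3))"
      "sin (real (Suc i) * (pi / 3)) = sin (real i * (pi / 3)) / 2 + sqrt 3 / 2 * cos (real i * (pi / 3))"
      by (simp_all only: cos_add sin_add cos_60 sin_60) simp_all
  qed
  have 0: "cos (real 0 * (pi / 3)) = 1" "sin (real 0 * (pi / 3)) = 0" by simp_all
  have 1: "cos (real 1 * (pi / 3)) = 1 / 2" "sin (real 1 * (pi / 3)) = sqrt 3 / 2"
    using step[of 0] by simp_all
  have 2: "cos (real 2 * (pi / 3)) = - 1 / 2" "sin (real 2 * (pi / 3)) = sqrt 3 / 2"
    using step[of 1] unfolding 1 by (simp_all add: numeral_2_eq_2)
  have 3: "cos (real 3 * (pi / 3)) = - 1" "sin (real 3 * (pi / 3)) = 0"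
    by simp_all
  have 4: "cos (real 4 * (pi / 3)) = - 1 / 2" "sin (real 4 * (pi / 3)) = - sqrt 3 / 2"
    using step[of 3] unfolding 3 by simp_all
  have 5: "cos (real 5 * (pi / 3)) = 1 / 2" "sin (real 5 * (pi / 3)) = - sqrt 3 / 2"
    using step[of 4] unfolding 4 by simp_all
  have dvd: "2 dvd n \<longleftrightarrow> 2 dvd j" "3 dvd n \<longleftrightarrow> 3 dvd j" "6 dvd n \<longleftrightarrow> 6 dvd j" "n mod 3 = j mod 3"
    unfolding n by presburger+
  have "j < 6" by (simp add: j_def)
  then consider "j = 0" | "j = 1" | "j = 2" | "j = 3" | "j = 4" | "j = 5" by linarith
  then show "cos (real n * (pi / 3)) =
     (1 - 2 * of_bool (2 dvd n) - 3 * of_bool (3 dvd n) + 6 * of_bool (6 dvd n)) / 2"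
    unfolding periodic dvd by cases (simp_all only: 0 1 2 3 4 5, simp_all)
  have "j = 0 \<or> j = 1 \<or> j = 2 \<or> j = 3 \<or> j = 4 \<or> j = 5" using \<open>j < 6\<close> by linarith
  then show "sin (real n * (pi / 3)) = sqrt 3 / 2 * (chi3 n - 2 * (of_bool (2 dvd n) * chi3 n))"
    unfolding periodic chi3_def dvd by (elim disjE) (simp_all only: 0 1 2 3 4 5, simp_all)
qed

section \<open>Boundary series as multiples of L and zeta values\<close>

lemma four_nine_power: "(2::real) ^ (q * 2) = 4 ^ q" "(3::real) ^ (q * 2) = 9 ^ q"
  by (simp_all add: mult.commute[of q] power_mult)

lemma sin_primitive_even: "sin_primitive (2 * q) n x = (- 1) ^ q * sin (real n * x) / real n ^ (2 * q)"
proof -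
  have "real (2 * q) * pi / 2 = real q * pi" by simp
  then show ?thesis by (simp only: sin_primitive_def sin_diff) simp
qed

lemma sin_primitive_odd:
  "sin_primitive (Suc (2 * q)) n x = - ((- 1) ^ q * cos (real n * x) / real n ^ Suc (2 * q))"
proof -
  have "real (Suc (2 * q)) * pi / 2 = pi / 2 + real q * pi" by (simp add: field_simps)
  then show ?thesis by (simp only: sin_primitive_def sin_diff cos_add sin_add) simp
qed

text \<open>Since chi3(2n) = - chi3(n), the even terms of the L-series sum to - L / 4^q; removing
  them twice gives the factor 1 + 2 / 4^q.\<close>

lemma sin_series_pi_third:
  assumes "0 < q"
  shows "(\<lambda>n. sin_primitive (2 * q) (Suc n) (pi / 3)) sums
    ((- 1) ^ q * (sqrt 3 / 2) * (1 + 2 / 4 ^ q) * L_series (2 * q) chi3)"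
proof -
  define L where "L = L_series (2 * q) chi3"
  have L: "(\<lambda>n. chi3 (Suc n) / real (Suc n) ^ (2 * q)) sums L"
    unfolding L_def using assms by (intro L_series_chi3_sums) simp
  have "chi3 (2 * n) = - chi3 n" for n unfolding chi3_def by simp presburger
  then have "(\<lambda>n. chi3 (2 * Suc n) / real (Suc n) ^ (2 * q)) sums (- L)"
    using sums_minus[OF L] by (simp del: mult_Suc_right of_nat_Suc)
  from sums_diff[OF L sums_mult[OF sums_dvd_indicator[OF _ this], of 2]]
  have "(\<lambda>n. chi3 (Suc n) / real (Suc n) ^ (2 * q) - 2 * (of_bool (2 dvd Suc n) * chi3 (Suc n) /
      real (Suc n) ^ (2 * q))) sums (L - 2 * (- L / real 2 ^ (2 * q)))" by simp
  from sums_mult[OF this, of "(- 1) ^ q * (sqrt 3 / 2)"] show ?thesis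
    unfolding sin_primitive_even cos_sin_pi_third L_def [symmetric]
    by (simp add: four_nine_power algebra_simps diff_divide_distrib add_divide_distrib)
qed

text \<open>The angle n(pi/3 + pi) is 4n pi/3, so \<open>cos_sin_pi_third\<close> applies at the
  even index 4n, where \<open>chi3\<close> agrees with its value at n.\<close>

lemma sin_series_four_pi_third:
  assumes "0 < q"
  shows "(\<lambda>n. sin_primitive (2 * q) (Suc n) (pi / 3 + pi)) sums
    (- ((- 1) ^ q * (sqrt 3 / 2) * L_series (2 * q) chi3))"
proof -
  have sin: "sin (real n * (pi / 3 + pi)) = - (sqrt 3 / 2) * chi3 n" for n
  proof -
    have "real n * (pi / 3 + pi) = real (4 * n) * (pi / 3)" by (simp add: field_simps)
    moreover have "chi3 (4 * n) = chi3 n" unfolding chi3_def by simp presburger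
    moreover have "2 dvd 4 * n" by simp
    ultimately show ?thesis by (simp only: cos_sin_pi_third) simp
  qed
  show ?thesis
    using sums_mult[OF L_series_chi3_sums[of "2 * q"], of "- ((- 1) ^ q * (sqrt 3 / 2))"] assms
    unfolding sin_primitive_even sin by (simp add: mult.assoc)
qed

lemma sin_series_0: "(\<lambda>n. sin_primitive (2 * q) (Suc n) 0) sums 0"
  unfolding sin_primitive_even by simp

lemma sin_series_pi: "(\<lambda>n. sin_primitive (2 * q) (Suc n) pi) sums 0"
  unfolding sin_primitive_even by (simp del: of_nat_Suc)

lemma cos_series_0:
  assumes "0 < q"
  shows "(\<lambda>n. sin_primitive (Suc (2 * q)) (Suc n) 0) sums (- ((- 1) ^ q) * zeta (2 * q + 1))"
  using sums_mult[OF zeta_sums[of "Suc (2 * q)"], of "- ((- 1) ^ q)"] assms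
  unfolding sin_primitive_odd by simp

lemma cos_series_pi:
  assumes "0 < q"
  shows "(\<lambda>n. sin_primitive (Suc (2 * q)) (Suc n) pi) sums
    (- ((- 1) ^ q) * ((1 / 4 ^ q - 1) * zeta (2 * q + 1)))"
proof -
  define z where "z = zeta (Suc (2 * q))"
  have "cos (real n * pi) = 2 * of_bool (2 dvd n) - 1" for n by (simp add: cos_npi)
  moreover have "(\<lambda>n. 2 * (of_bool (2 dvd Suc n) / real (Suc n) ^ Suc (2 * q)) - 1 / real (Suc n) ^ Suc (2 * q))
      sums (2 * (z / real 2 ^ Suc (2 * q)) - z)"
    unfolding z_def using assms by (intro sums_diff sums_mult zeta_dvd_sums zeta_sums) auto
  from sums_mult[OF this, of "- ((- 1) ^ q)"]
  show ?thesis
    unfolding sin_primitive_odd calculation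
    by (simp add: z_def four_nine_power algebra_simps diff_divide_distrib)
qed

text \<open>With s = 2q + 1 the indicators contribute the factor (1 - 2^(1-s) - 3^(1-s) + 6^(1-s)) /
  2, which factors like a piece of an Euler product.\<close>

lemma cos_series_pi_third:
  assumes "0 < q"
  shows "(\<lambda>n. sin_primitive (Suc (2 * q)) (Suc n) (pi / 3)) sums
    (- ((- 1) ^ q) * ((1 - 1 / 4 ^ q) * (1 - 1 / 9 ^ q) / 2 * zeta (2 * q + 1)))"
proof -
  define z where "z = zeta (Suc (2 * q))"
  define s where "s = Suc (2 * q)"
  have "(\<lambda>n. 1 / 2 * (1 / real (Suc n) ^ s) - of_bool (2 dvd Suc n) / real (Suc n) ^ s
      - 3 / 2 * (of_bool (3 dvd Suc n) / real (Suc n) ^ s) + 3 * (of_bool (6 dvd Suc n) / real (Suc n) ^ s))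
      sums (1 / 2 * z - z / real 2 ^ s - 3 / 2 * (z / real 3 ^ s) + 3 * (z / real 6 ^ s))"
    unfolding z_def s_def using assms by (intro sums_diff sums_add sums_mult zeta_dvd_sums zeta_sums) auto
  from sums_mult[OF this, of "- ((- 1) ^ q)"]
  have "(\<lambda>n. sin_primitive (Suc (2 * q)) (Suc n) (pi / 3)) sums (- ((- 1) ^ q) *
      (1 / 2 * z - z / real 2 ^ s - 3 / 2 * (z / real 3 ^ s) + 3 * (z / real 6 ^ s)))"
    unfolding sin_primitive_odd cos_sin_pi_third s_def
    by (simp add: diff_divide_distrib add_divide_distrib algebra_simps)
  moreover have "1 / 2 * z - z / real 2 ^ s - 3 / 2 * (z / real 3 ^ s) + 3 * (z / real 6 ^ s) =
      (1 - 1 / 4 ^ q) * (1 - 1 / 9 ^ q) / 2 * z"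
  proof -
    have "(2::real) ^ s = 2 * 4 ^ q" "(3::real) ^ s = 3 * 9 ^ q" "(6::real) ^ s = 6 * (4 ^ q * 9 ^ q)"
      unfolding s_def by (simp_all add: power_mult flip: power_mult_distrib)
    then show ?thesis by (simp add: field_simps)
  qed
  ultimately show ?thesis by (simp only: z_def Suc_eq_plus1)
qed

lemma cos_series_four_pi_third:
  assumes "0 < q"
  shows "(\<lambda>n. sin_primitive (Suc (2 * q)) (Suc n) (pi / 3 + pi)) sums
    (- ((- 1) ^ q) * ((1 / 9 ^ q - 1) / 2 * zeta (2 * q + 1)))"
proof -
  define z where "z = zeta (Suc (2 * q))"
  define s where "s = Suc (2 * q)"
  have cos: "cos (real n * (pi / 3 + pi)) = (3 * of_bool (3 dvd n) - 1) / 2" for n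
  proof -
    have "real n * (pi / 3 + pi) = real (4 * n) * (pi / 3)" by (simp add: field_simps)
    moreover have "2 dvd 4 * n" "3 dvd 4 * n \<longleftrightarrow> 3 dvd n" "6 dvd 4 * n \<longleftrightarrow> 3 dvd n" by presburger+
    ultimately show ?thesis by (simp only: cos_sin_pi_third) simp
  qed
  have "(\<lambda>n. 3 / 2 * (of_bool (3 dvd Suc n) / real (Suc n) ^ s) - 1 / 2 * (1 / real (Suc n) ^ s))
      sums (3 / 2 * (z / real 3 ^ s) - 1 / 2 * z)"
    unfolding z_def s_def using assms by (intro sums_diff sums_mult zeta_dvd_sums zeta_sums) auto
  from sums_mult[OF this, of "- ((- 1) ^ q)"]
  show ?thesis
    unfolding sin_primitive_odd cos s_def
    by (simp add: z_def four_nine_power algebra_simps diff_divide_distrib)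
qed

text \<open>In each block of d consecutive indices exactly one \<open>Suc n\<close> is a multiple of
  d, namely the last.\<close>

lemma sum_dvd_indicator_harm:
  assumes "0 < d"
  shows "(\<Sum>n<d * K. of_bool (d dvd Suc n) / real (Suc n)) = harm K / real d"
proof -
  have split: "{..<d * Suc K} = {..<d * K} \<union> {d * K..<d * K + d}" for K
    by (auto simp: algebra_simps)
  show ?thesis
  proof (induction K)
    case (Suc K)
    have "(\<Sum>n\<in>{d * K..<d * K + d}. of_bool (d dvd Suc n) / real (Suc n)) =
        (\<Sum>n\<in>{d * K + d - 1}. of_bool (d dvd Suc n) / real (Suc n))"
    proof (rule sum.mono_neutral_right)
      show "\<forall>i\<in>{d * K..<d * K + d} - {d * K + d - 1}. of_bool (d dvd Suc i) / real (Suc i) = 0"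
      proof
        fix i assume i: "i \<in> {d * K..<d * K + d} - {d * K + d - 1}"
        have "\<not> d dvd Suc i"
        proof
          assume "d dvd Suc i"
          then have "d dvd Suc i - d * K" by (simp add: dvd_diff_nat)
          moreover have "0 < Suc i - d * K" "Suc i - d * K < d" using i by auto
          ultimately show False using nat_dvd_not_less by blast
        qed
        then show "of_bool (d dvd Suc i) / real (Suc i) = 0" by simp
      qed
    qed (use assms in auto)
    also have "\<dots> = 1 / (real d * real (Suc K))"
    proof -
      have "Suc (d * K + d - 1) = d * Suc K" using assms by simp
      then show ?thesis by (simp del: of_nat_Suc mult_Suc_right)
    qed
    finally have block: "(\<Sum>n\<in>{d * K..<d * K + d}. of_bool (d dvd Suc n) / real (Suc n)) =
        1 / (real d * real (Suc K))" .
    have "(\<Sum>n<d * Suc K. of_bool (d dvd Suc n) / real (Suc n)) = harm K / real d + 1 / (real d * real (Suc K))"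
      unfolding split by (subst sum.union_disjoint) (auto simp only: Suc block, auto)
    also have "\<dots> = harm (Suc K) / real d"
      by (simp add: harm_Suc add_divide_distrib inverse_eq_divide mult.commute)
    finally show ?case .
  qed (simp add: harm_def)
qed

text \<open>At cutoffs 6M the partial sums are a combination of the harmonic numbers at 6M, 3M, 2M
  and M with signs +, -, -, +. Both the logarithms and the Euler constants cancel, the former
  because 6 = 3 * 2.\<close>

lemma cos_harmonic_series_pi_third:
  "(\<lambda>M. \<Sum>n<6 * M. sin_primitive 1 (Suc n) (pi / 3)) \<longlonglongrightarrow> 0"
proof -
  define h where "h n = (harm n - ln (real n) :: real)" for n
  have h: "(\<lambda>M. h (c * M)) \<longlonglongrightarrow> euler_mascheroni" if "0 < c" for c
  proof -
    have "h \<longlonglongrightarrow> euler_mascheroni"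
      using euler_mascheroni_LIMSEQ by (simp add: h_def [abs_def])
    moreover have "strict_mono (\<lambda>M. c * M)" using that by (simp add: strict_mono_def)
    ultimately show ?thesis using LIMSEQ_subseq_LIMSEQ[of h _ "\<lambda>M. c * M"] by (simp add: o_def)
  qed
  have "(\<Sum>n<6 * M. sin_primitive 1 (Suc n) (pi / 3)) =
      - (h (6 * M) - h (3 * M) - h (2 * M) + h (1 * M)) / 2" if "0 < M" for M
  proof -
    have "(\<Sum>n<6 * M. sin_primitive 1 (Suc n) (pi / 3)) =
        (\<Sum>n<6 * M. - (1 / 2 * (of_bool (1 dvd Suc n) / real (Suc n)) - of_bool (2 dvd Suc n) / real (Suc n)
          - 3 / 2 * (of_bool (3 dvd Suc n) / real (Suc n)) + 3 * (of_bool (6 dvd Suc n) / real (Suc n))))"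
      using sin_primitive_odd[of 0, simplified] unfolding One_nat_def
      by (intro sum.cong)
        (simp_all only: cos_sin_pi_third, simp_all add: diff_divide_distrib add_divide_distrib del: of_nat_Suc)
    also have "\<dots> = - (1 / 2 * (\<Sum>n<1 * (6 * M). of_bool (1 dvd Suc n) / real (Suc n))
        - (\<Sum>n<2 * (3 * M). of_bool (2 dvd Suc n) / real (Suc n))
        - 3 / 2 * (\<Sum>n<3 * (2 * M). of_bool (3 dvd Suc n) / real (Suc n))
        + 3 * (\<Sum>n<6 * M. of_bool (6 dvd Suc n) / real (Suc n)))"
      by (simp add: sum_negf sum.distrib sum_subtractf sum_distrib_left del: of_nat_Suc)
    also have "\<dots> = - (harm (6 * M) - harm (3 * M) - harm (2 * M) + harm M) / 2"
      by (subst sum_dvd_indicator_harm, simp)+ (simp add: field_simps)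
    also have "\<dots> = - (h (6 * M) - h (3 * M) - h (2 * M) + h (1 * M)) / 2"
    proof -
      have "(6::real) = 3 * 2" by simp
      then have "ln (6::real) = ln 3 + ln 2" by (simp only: ln_mult) simp
      then show ?thesis using that by (simp add: h_def ln_mult)
    qed
    finally show ?thesis .
  qed
  note eq = this
  have ev: "\<forall>\<^sub>F M in sequentially. (\<Sum>n<6 * M. sin_primitive 1 (Suc n) (pi / 3)) =
      - (h (6 * M) - h (3 * M) - h (2 * M) + h (1 * M)) / 2"
    using eventually_gt_at_top[of 0] by eventually_elim (rule eq)
  have "(\<lambda>M. - (h (6 * M) - h (3 * M) - h (2 * M) + h (1 * M)) / 2) \<longlonglongrightarrow>
      - (euler_mascheroni - euler_mascheroni - euler_mascheroni + euler_mascheroni) / 2"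
    by (intro tendsto_intros h) auto
  then show ?thesis unfolding tendsto_cong[OF ev] by simp
qed

section \<open>Evaluation of the integrals\<close>

text \<open>One factor t removes the singularity, t / sin(t/2) tending to 2 at 0. For b >= 2 the
  remaining t^(b-1) still vanishes at 0, which matches the value 0 that division by 0 assigns
  there.\<close>

lemma continuous_on_div_sin_half:
  assumes "2 \<le> b"
  shows "continuous_on {0..pi / 3} (\<lambda>t::real. (u - t) ^ a / fact a * (t ^ b / fact b) / sin ((t + 0) / 2))"
proof -
  define h where "h t = (if t = 0 then 2 else t / sin (t / 2))" for t :: real
  have pos: "0 < sin (t / 2)" if "t \<in> {0..pi / 3}" "t \<noteq> 0" for t :: real
  proof (rule sin_gt_zero)
    show "0 < t / 2" using that by simp
    show "t / 2 < pi" using that pi_gt_zero unfolding atLeastAtMost_iff by linarith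
  qed
  have "continuous_on {0..pi / 3} h"
    unfolding continuous_on_eq_continuous_within
  proof
    fix t :: real assume t: "t \<in> {0..pi / 3}"
    show "continuous (at t within {0..pi / 3}) h"
    proof (cases "t = 0")
      case True
      have "((\<lambda>t::real. t / sin (t / 2)) \<longlongrightarrow> 2) (at 0)" by real_asymp
      then have "(h \<longlongrightarrow> 2) (at 0)"
        by (rule Lim_transform_eventually) (auto simp: h_def eventually_at_filter)
      then have "isCont h 0" by (simp add: isCont_def h_def)
      then show ?thesis using True continuous_at_imp_continuous_at_within by blast
    next
      case False
      have "\<forall>\<^sub>F x in nhds t. x \<noteq> 0" using False by (rule t1_space_nhds)
      then have "\<forall>\<^sub>F x in nhds t. h x = x / sin (x / 2)"
        by eventually_elim (simp add: h_def)
      moreover have "isCont (\<lambda>x. x / sin (x / 2)) t"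
        using pos[OF t False] by (intro continuous_intros) auto
      ultimately have "isCont h t" by (simp add: isCont_cong)
      then show ?thesis using continuous_at_imp_continuous_at_within by blast
    qed
  qed
  then have "continuous_on {0..pi / 3} (\<lambda>t. (u - t) ^ a / fact a * (t ^ (b - 1) / fact b) * h t)"
    by (intro continuous_intros) auto
  moreover have "t ^ b = t ^ (b - 1) * t" for t :: real
    using assms by (cases b) auto
  then have "(u - t) ^ a / fact a * (t ^ (b - 1) / fact b) * h t =
      (u - t) ^ a / fact a * (t ^ b / fact b) / sin ((t + 0) / 2)" for t :: real
    using assms by (auto simp: h_def power_0_left mult_ac)
  ultimately show ?thesis by simp
qed

lemma continuous_on_div_cos_half:
  "continuous_on {0..pi / 3} (\<lambda>t::real. (u - t) ^ a / fact a * (t ^ b / fact b) / sin ((t + pi) / 2))"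
proof (intro continuous_intros ballI)
  fix t :: real assume "t \<in> {0..pi / 3}"
  then have t: "0 \<le> t" "t \<le> pi / 3" by auto
  have "0 < (t + pi) / 2" using t(1) by (simp add: add_nonneg_pos)
  moreover have "(t + pi) / 2 < pi" using t pi_gt3 by simp
  ultimately show "sin ((t + pi) / 2) \<noteq> 0" by (metis less_irrefl sin_gt_zero)
qed auto

text \<open>The two cases \<open>c = 0\<close> and \<open>c = pi\<close> treat the kernels \<open>cot (t / 2)\<close> and \<open>- tan (t / 2)\<close>
  simultaneously. The boundary term at \<open>pi / 3\<close> without differentiation is the conditionally
  convergent series \<open>\<Sum>n. cos (n * pi / 3) / n = 0\<close> if \<open>c = 0\<close>, and has coefficient 0 if
  \<open>c = pi\<close>.\<close>

lemma cot_integral_eq_sum: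
  fixes A B :: "nat \<Rightarrow> real"
  assumes c: "c = 0 \<and> 2 \<le> b \<or> c = pi \<and> 0 < a \<and> 0 < b"
    and J: "((\<lambda>t. (pi / 3 - t) ^ a / fact a * (t ^ b / fact b) * cot ((t + c) / 2)) has_integral J) {0..pi / 3}"
    and A: "\<And>r. 0 < r \<Longrightarrow> (\<lambda>n. sin_primitive (Suc r) (Suc n) (pi / 3 + c)) sums A r"
    and B: "\<And>r. 0 < r \<Longrightarrow> (\<lambda>n. sin_primitive (Suc r) (Suc n) c) sums B r"
  shows "J = 2 * (\<Sum>r=1..a + b. (- 1) ^ r *
    (beta_deriv (pi / 3) a b r (pi / 3) * A r - beta_deriv (pi / 3) a b r 0 * B r))"
proof -
  define D where "D = beta_deriv (pi / 3) a b"
  define e where "e r n x = sin_primitive (Suc r) (Suc n) x" for r n x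
  have D0: "D 0 t = (pi / 3 - t) ^ a / fact a * (t ^ b / fact b)" for t
    unfolding D_def by (rule beta_deriv_0)
  have Dc: "D 0 0 = 0" "c = 0 \<or> D 0 (pi / 3) = 0" using c by (auto simp: D0)
  have int: "integral {0..pi / 3} (\<lambda>t. D 0 t * sin (real (Suc n) * (t + c))) =
      (\<Sum>r\<le>a + b. (- 1) ^ r * (D r (pi / 3) * e r n (pi / 3 + c) - D r 0 * e r n c))" for n
    using integral_sin_by_parts[of "Suc n" 0 "pi / 3" D "a + b" c]
      beta_deriv_deriv beta_deriv_eq_0 unfolding D_def e_def by simp
  have "(\<lambda>N. \<Sum>n<N. 2 * integral {0..pi / 3} (\<lambda>t. D 0 t * sin (real (Suc n) * (t + c)))) \<longlonglongrightarrow> J"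
  proof (rule cot_integral_sine_series)
    show "continuous_on {0..pi / 3} (D 0)" unfolding D0 by (intro continuous_intros) auto
    show "continuous_on {0..pi / 3} (\<lambda>t. D 0 t / sin ((t + c) / 2))"
      unfolding D0 using c continuous_on_div_sin_half[of b "pi / 3" a]
        continuous_on_div_cos_half[of "pi / 3" a b] by auto
    show "((\<lambda>t. D 0 t * cot ((t + c) / 2)) has_integral J) {0..pi / 3}"
      using J unfolding D0 .
    fix t assume t: "t \<in> {0..pi / 3}" "sin ((t + c) / 2) = 0"
    then have "t = 0"
    proof (rule_tac ccontr)
      assume "t \<noteq> 0"
      then have "0 < t" "t \<le> pi / 3" "0 \<le> c" "c \<le> pi" using c t(1) by auto
      then have "0 < (t + c) / 2" "(t + c) / 2 < pi" using pi_gt_zero by auto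
      then show False using sin_gt_zero[of "(t + c) / 2"] t(2) by simp
    qed
    then show "D 0 t = 0" using Dc by simp
  qed simp
  \<comment> \<open>The full sequence is already known to converge, so its limit may be read off at
    multiples of 6, where the conditionally convergent boundary series is controlled.\<close>
  then have "(\<lambda>M. \<Sum>n<6 * M. 2 * integral {0..pi / 3} (\<lambda>t. D 0 t * sin (real (Suc n) * (t + c)))) \<longlonglongrightarrow> J"
    using LIMSEQ_subseq_LIMSEQ[of _ J "\<lambda>M. 6 * M"] by (simp add: o_def strict_mono_def)
  moreover have "(\<Sum>n<N. 2 * integral {0..pi / 3} (\<lambda>t. D 0 t * sin (real (Suc n) * (t + c)))) =
      2 * (D 0 (pi / 3) * (\<Sum>n<N. e 0 n (pi / 3 + c)) +
      (\<Sum>r=1..a + b. (- 1) ^ r * (D r (pi / 3) * (\<Sum>n<N. e r n (pi / 3 + c)) - D r 0 * (\<Sum>n<N. e r n c))))" for N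
  proof -
    have "(\<Sum>n<N. 2 * integral {0..pi / 3} (\<lambda>t. D 0 t * sin (real (Suc n) * (t + c)))) =
       2 * (\<Sum>r\<le>a + b. \<Sum>n<N. (- 1) ^ r * (D r (pi / 3) * e r n (pi / 3 + c) - D r 0 * e r n c))"
      unfolding int by (simp only: sum_distrib_left [symmetric, of 2] sum.swap[of _ "{..<N}"])
    also have "\<dots> = 2 * (\<Sum>r\<le>a + b. (- 1) ^ r * (D r (pi / 3) * (\<Sum>n<N. e r n (pi / 3 + c)) - D r 0 * (\<Sum>n<N. e r n c)))"
      by (simp add: sum_distrib_left sum_subtractf right_diff_distrib)
    also have "{..a + b} = insert 0 {1..a + b}" by auto
    finally show ?thesis using Dc(1) by simp
  qed
  moreover have "(\<lambda>M. 2 * (D 0 (pi / 3) * (\<Sum>n<6 * M. e 0 n (pi / 3 + c)) +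
      (\<Sum>r=1..a + b. (- 1) ^ r * (D r (pi / 3) * (\<Sum>n<6 * M. e r n (pi / 3 + c)) - D r 0 * (\<Sum>n<6 * M. e r n c)))))
      \<longlonglongrightarrow> 2 * (0 + (\<Sum>r=1..a + b. (- 1) ^ r * (D r (pi / 3) * A r - D r 0 * B r)))"
  proof (intro tendsto_intros)
    show "(\<lambda>M. D 0 (pi / 3) * (\<Sum>n<6 * M. e 0 n (pi / 3 + c))) \<longlonglongrightarrow> 0"
      using Dc(2) tendsto_mult_right_zero[OF cos_harmonic_series_pi_third] by (auto simp: e_def)
    have sub: "(\<lambda>M. \<Sum>n<6 * M. f n) \<longlonglongrightarrow> S" if "f sums S" for f :: "nat \<Rightarrow> real" and S
      using that LIMSEQ_subseq_LIMSEQ[of _ S "\<lambda>M. 6 * M"] by (simp add: sums_def o_def strict_mono_def)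
    fix r assume "r \<in> {1..a + b}"
    then show "(\<lambda>M. \<Sum>n<6 * M. e r n (pi / 3 + c)) \<longlonglongrightarrow> A r" "(\<lambda>M. \<Sum>n<6 * M. e r n c) \<longlonglongrightarrow> B r"
      unfolding e_def using A[of r] B[of r] by (auto intro: sub)
  qed
  ultimately show ?thesis unfolding D_def using LIMSEQ_unique by fastforce
qed

lemma sum_pairs: "(\<Sum>r=1..2 * m. f r) = (\<Sum>q=1..m. f (2 * q - 1) + f (2 * q :: nat) :: real)"
  by (induction m) (simp_all add: algebra_simps)

text \<open>The factors \<open>2 / 4 ^ q\<close> and \<open>2 * q / 4 ^ q\<close> are chosen such that the coefficients of the sums
  \<open>\<sigma>\<close> become 2-integral.\<close>

definition L_part :: "nat \<Rightarrow> nat \<Rightarrow> real" where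
  "L_part m q = (- 1) ^ Suc q * ((pi / 3) ^ (2 * m + 1 - 2 * q) / fact (2 * m + 1 - 2 * q)) *
     sqrt 3 * L_series (2 * q) chi3 * (2 / 4 ^ q)"

definition zeta_part :: "nat \<Rightarrow> nat \<Rightarrow> real" where
  "zeta_part m q = 2 * (- 1) ^ Suc q * ((pi / 3) ^ (2 * m - 2 * q) / fact (2 * m - 2 * q)) *
     zeta (2 * q + 1) * (2 * real q / 4 ^ q)"

text \<open>Odd r = 2q - 1 meets primitives of even order 2q, that is sine series and L(2q, chi);
  even r = 2q meets cosine series and zeta(2q + 1). \<open>X\<close>, \<open>Y\<close> and
  \<open>Z\<close> are the rational factors of these series: \<open>X\<close> and \<open>Y\<close>
  at the right endpoint, \<open>Z\<close> at the left.\<close>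

lemma cot_integral_eq_sum_parts:
  fixes X Y Z :: "nat \<Rightarrow> real"
  assumes ab: "a + b = 2 * m"
    and c: "c = 0 \<and> 2 \<le> b \<or> c = pi \<and> 0 < a \<and> 0 < b"
    and J: "((\<lambda>t. (pi / 3 - t) ^ a / fact a * (t ^ b / fact b) * cot ((t + c) / 2)) has_integral J) {0..pi / 3}"
    and X: "\<And>q. 0 < q \<Longrightarrow> (\<lambda>n. sin_primitive (2 * q) (Suc n) (pi / 3 + c)) sums
        ((- 1) ^ q * (sqrt 3 / 2) * X q * L_series (2 * q) chi3)"
    and Y: "\<And>q. 0 < q \<Longrightarrow> (\<lambda>n. sin_primitive (Suc (2 * q)) (Suc n) (pi / 3 + c)) sums
        (- ((- 1) ^ q) * (Y q * zeta (2 * q + 1)))"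
    and Z: "\<And>q. 0 < q \<Longrightarrow> (\<lambda>n. sin_primitive (Suc (2 * q)) (Suc n) c) sums
        (- ((- 1) ^ q) * (Z q * zeta (2 * q + 1)))"
  shows "J = (- 1) ^ a * (\<Sum>q=1..m. real ((2 * q - 1) choose a) * X q * (4 ^ q / 2) * L_part m q +
    (real ((2 * q) choose a) * Y q - real ((2 * q) choose b) * Z q) * 4 ^ q / (2 * real q) * zeta_part m q)"
proof -
  define A where "A r = (if odd r then (- 1) ^ (Suc r div 2) * (sqrt 3 / 2) * X (Suc r div 2) * L_series (Suc r) chi3
      else - ((- 1) ^ (r div 2)) * (Y (r div 2) * zeta (r + 1)))" for r
  define B where "B r = (if odd r then 0 else - ((- 1) ^ (r div 2)) * (Z (r div 2) * zeta (r + 1)))" for r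
  have "J = 2 * (\<Sum>r=1..a + b. (- 1) ^ r *
    (beta_deriv (pi / 3) a b r (pi / 3) * A r - beta_deriv (pi / 3) a b r 0 * B r))"
  proof (rule cot_integral_eq_sum[OF c J])
    fix r :: nat assume r: "0 < r"
    have S: "(\<lambda>n. sin_primitive (2 * q) (Suc n) c) sums 0" for q
      using c sin_series_0 sin_series_pi by auto
    have "(\<lambda>n. sin_primitive (Suc r) (Suc n) (pi / 3 + c)) sums A r \<and>
        (\<lambda>n. sin_primitive (Suc r) (Suc n) c) sums B r"
    proof (cases "even r")
      case True
      then obtain q where "r = 2 * q" by (elim evenE)
      then show ?thesis using Y[of q] Z[of q] r by (simp add: A_def B_def)
    next
      case False
      then have "even (Suc r)" by simp
      then obtain q where "Suc r = 2 * q" by (elim evenE)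
      then show ?thesis using X[of q] S[of q] False by (simp add: A_def B_def)
    qed
    then show "(\<lambda>n. sin_primitive (Suc r) (Suc n) (pi / 3 + c)) sums A r"
      "(\<lambda>n. sin_primitive (Suc r) (Suc n) c) sums B r" by auto
  qed
  also have "\<dots> = 2 * (\<Sum>q=1..m.
      (- 1) ^ (2 * q - 1) * (beta_deriv (pi / 3) a b (2 * q - 1) (pi / 3) * A (2 * q - 1)
         - beta_deriv (pi / 3) a b (2 * q - 1) 0 * B (2 * q - 1)) +
      (- 1) ^ (2 * q) * (beta_deriv (pi / 3) a b (2 * q) (pi / 3) * A (2 * q)
         - beta_deriv (pi / 3) a b (2 * q) 0 * B (2 * q)))"
    unfolding ab sum_pairs ..
  also have "\<dots> = (\<Sum>q=1..m. (- 1) ^ a * (real ((2 * q - 1) choose a) * X q * (4 ^ q / 2) * L_part m q +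
    (real ((2 * q) choose a) * Y q - real ((2 * q) choose b) * Z q) * 4 ^ q / (2 * real q) * zeta_part m q))"
    unfolding sum_distrib_left
  proof (rule sum.cong)
    fix q assume q: "q \<in> {1..m}"
    define U where "U = (pi / 3) ^ (2 * m + 1 - 2 * q) / fact (2 * m + 1 - 2 * q)"
    define V where "V = (pi / 3) ^ (2 * m - 2 * q) / fact (2 * m - 2 * q)"
    have odd: "odd (2 * q - 1)" "Suc (2 * q - 1) = 2 * q" "2 * m - (2 * q - 1) = 2 * m + 1 - 2 * q" using q by auto
    \<comment> \<open>As a + b is even, the sign from the left endpoint agrees with that from the
      right and can be pulled out of the sum.\<close>
    have sgn: "(- 1 :: real) ^ b = (- 1) ^ a"
      using ab by (metis even_add even_mult_iff even_numeral minus_one_power_iff)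
    have r1: "beta_deriv (pi / 3) a b (2 * q - 1) (pi / 3) = (- 1) ^ a * real ((2 * q - 1) choose a) * U"
      using beta_deriv_at_right[of "2 * q - 1" a b "pi / 3"] q unfolding ab odd U_def by auto
    have r2: "beta_deriv (pi / 3) a b (2 * q) (pi / 3) = (- 1) ^ a * real ((2 * q) choose a) * V"
      using beta_deriv_at_right[of "2 * q" a b "pi / 3"] q unfolding ab V_def by auto
    have l2: "beta_deriv (pi / 3) a b (2 * q) 0 = (- 1) ^ a * real ((2 * q) choose b) * V"
      using beta_deriv_at_left[of "2 * q" a b "pi / 3"] q unfolding ab V_def by (auto simp: power_add sgn)
    have AB: "A (2 * q - 1) = (- 1) ^ q * (sqrt 3 / 2) * X q * L_series (2 * q) chi3" "B (2 * q - 1) = 0"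
      "A (2 * q) = - ((- 1) ^ q) * (Y q * zeta (2 * q + 1))" "B (2 * q) = - ((- 1) ^ q) * (Z q * zeta (2 * q + 1))"
    proof -
      have "Suc (2 * q - 1) div 2 = q" unfolding odd by simp
      then show "A (2 * q - 1) = (- 1) ^ q * (sqrt 3 / 2) * X q * L_series (2 * q) chi3" "B (2 * q - 1) = 0"
        using odd(1) unfolding A_def B_def odd(2) by simp_all
    qed (simp_all add: A_def B_def)
    have parts: "L_part m q = - ((- 1) ^ q) * U * sqrt 3 * L_series (2 * q) chi3 * (2 / 4 ^ q)"
      "zeta_part m q = - (2 * (- 1) ^ q) * V * zeta (2 * q + 1) * (2 * real q / 4 ^ q)"
      by (simp_all add: L_part_def zeta_part_def U_def V_def)
    have pow: "(- 1 :: real) ^ (2 * q - 1) = - 1" "(- 1 :: real) ^ (2 * q) = 1" using odd(1) by simp_all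
    have "q \<noteq> 0" using q by simp
    then show "2 * ((- 1) ^ (2 * q - 1) * (beta_deriv (pi / 3) a b (2 * q - 1) (pi / 3) * A (2 * q - 1)
         - beta_deriv (pi / 3) a b (2 * q - 1) 0 * B (2 * q - 1)) +
      (- 1) ^ (2 * q) * (beta_deriv (pi / 3) a b (2 * q) (pi / 3) * A (2 * q)
         - beta_deriv (pi / 3) a b (2 * q) 0 * B (2 * q))) =
      (- 1) ^ a * (real ((2 * q - 1) choose a) * X q * (4 ^ q / 2) * L_part m q +
        (real ((2 * q) choose a) * Y q - real ((2 * q) choose b) * Z q) * 4 ^ q / (2 * real q) * zeta_part m q)"
      unfolding r1 r2 l2 AB parts pow by (simp add: field_simps)
  qed simp
  finally show ?thesis by (simp only: sum_distrib_left)
qed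

section \<open>Explicit expansions of the two families\<close>

lemma \<sigma>_232_eq_sum:
  assumes "i + l = m" "0 < l"
  shows "\<sigma> (replicate i 2 @ [3] @ replicate (l - 1) 2) =
    (\<Sum>q=1..m. real ((2 * q - 1) choose (2 * i)) * (1 + 2 / 4 ^ q) * (4 ^ q / 2) * L_part m q +
      (real ((2 * q) choose (2 * i)) * ((1 - 1 / 4 ^ q) * (1 - 1 / 9 ^ q) / 2) - real ((2 * q) choose (2 * l)) * 1) *
        4 ^ q / (2 * real q) * zeta_part m q)"
proof -
  have eq: "2 * (l - 1) + 2 = 2 * l" using assms by simp
  have J: "((\<lambda>t. (pi / 3 - t) ^ (2 * i) / fact (2 * i) * (t ^ (2 * l) / fact (2 * l)) * cot ((t + 0) / 2))
      has_integral \<sigma> (replicate i 2 @ [3] @ replicate (l - 1) 2)) {0..pi / 3}"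
    using \<sigma>_232_has_integral[of i "l - 1"] unfolding eq by simp
  have "\<sigma> (replicate i 2 @ [3] @ replicate (l - 1) 2) = (- 1) ^ (2 * i) *
    (\<Sum>q=1..m. real ((2 * q - 1) choose (2 * i)) * (1 + 2 / 4 ^ q) * (4 ^ q / 2) * L_part m q +
      (real ((2 * q) choose (2 * i)) * ((1 - 1 / 4 ^ q) * (1 - 1 / 9 ^ q) / 2) - real ((2 * q) choose (2 * l)) * 1) *
        4 ^ q / (2 * real q) * zeta_part m q)"
  proof (rule cot_integral_eq_sum_parts[OF _ _ J])
    fix q :: nat assume q: "0 < q"
    show "(\<lambda>n. sin_primitive (2 * q) (Suc n) (pi / 3 + 0)) sums
        ((- 1) ^ q * (sqrt 3 / 2) * (1 + 2 / 4 ^ q) * L_series (2 * q) chi3)"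
      using sin_series_pi_third[OF q] by simp
    show "(\<lambda>n. sin_primitive (Suc (2 * q)) (Suc n) (pi / 3 + 0)) sums
        (- ((- 1) ^ q) * ((1 - 1 / 4 ^ q) * (1 - 1 / 9 ^ q) / 2 * zeta (2 * q + 1)))"
      using cos_series_pi_third[OF q] by simp
    show "(\<lambda>n. sin_primitive (Suc (2 * q)) (Suc n) 0) sums (- ((- 1) ^ q) * (1 * zeta (2 * q + 1)))"
      using cos_series_0[OF q] by simp
  qed (use assms in auto)
  then show ?thesis by simp
qed

text \<open>Shifting the argument of the cotangent by pi/2 gives minus the tangent, so the integral
  is minus the sum sought; this sign cancels against (-1)^(2i-1).\<close>

lemma \<sigma>_212_eq_sum:
  assumes "i + j = m" "0 < i"
  shows "\<sigma> (replicate i 2 @ [1] @ replicate j 2) =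
    (\<Sum>q=1..m. real ((2 * q - 1) choose (2 * i - 1)) * (- 1) * (4 ^ q / 2) * L_part m q +
      (real ((2 * q) choose (2 * i - 1)) * ((1 / 9 ^ q - 1) / 2) - real ((2 * q) choose (2 * j + 1)) * (1 / 4 ^ q - 1)) *
        4 ^ q / (2 * real q) * zeta_part m q)"
proof -
  have J: "((\<lambda>t. (pi / 3 - t) ^ (2 * i - 1) / fact (2 * i - 1) * (t ^ (2 * j + 1) / fact (2 * j + 1)) * cot ((t + pi) / 2))
      has_integral - \<sigma> (replicate i 2 @ [1] @ replicate j 2)) {0..pi / 3}"
  proof -
    have "cot ((t + pi) / 2) = - tan (t / 2)" for t :: real
      by (simp add: cot_def tan_def add_divide_distrib sin_add cos_add)
    then show ?thesis using has_integral_neg[OF \<sigma>_212_has_integral[OF assms(2), of j]] by simp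
  qed
  have "- \<sigma> (replicate i 2 @ [1] @ replicate j 2) = (- 1) ^ (2 * i - 1) *
    (\<Sum>q=1..m. real ((2 * q - 1) choose (2 * i - 1)) * (- 1) * (4 ^ q / 2) * L_part m q +
      (real ((2 * q) choose (2 * i - 1)) * ((1 / 9 ^ q - 1) / 2) - real ((2 * q) choose (2 * j + 1)) * (1 / 4 ^ q - 1)) *
        4 ^ q / (2 * real q) * zeta_part m q)"
  proof (rule cot_integral_eq_sum_parts[OF _ _ J])
    fix q :: nat assume q: "0 < q"
    show "(\<lambda>n. sin_primitive (2 * q) (Suc n) (pi / 3 + pi)) sums
        ((- 1) ^ q * (sqrt 3 / 2) * (- 1) * L_series (2 * q) chi3)"
      using sin_series_four_pi_third[OF q] by simp
    show "(\<lambda>n. sin_primitive (Suc (2 * q)) (Suc n) (pi / 3 + pi)) sums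
        (- ((- 1) ^ q) * ((1 / 9 ^ q - 1) / 2 * zeta (2 * q + 1)))"
      using cos_series_four_pi_third[OF q] by simp
    show "(\<lambda>n. sin_primitive (Suc (2 * q)) (Suc n) pi) sums (- ((- 1) ^ q) * ((1 / 4 ^ q - 1) * zeta (2 * q + 1)))"
      using cos_series_pi[OF q] by simp
  qed (use assms in auto)
  moreover have "(- 1 :: real) ^ (2 * i - 1) = - 1" using assms(2) by (simp add: minus_one_power_iff)
  ultimately show ?thesis by simp
qed

section \<open>The coefficient matrix\<close>

lemma odd_denom_half: "x / 2 \<in> odd_denom \<Longrightarrow> x \<in> odd_denom"
  using odd_denom_mult[of 2 "x / 2"] by simp

text \<open>The absorption identity trades the denominator 2q, which is even, for the odd number 2n
  - 1.\<close>

lemma binomial_2q_div: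
  assumes "0 < q" "0 < n"
  shows "real ((2 * q) choose (2 * n - 1)) / (2 * real q) = real ((2 * q - 1) choose (2 * n - 2)) / real (2 * n - 1)"
proof -
  have "Suc (2 * n - 2) = 2 * n - 1" "Suc (2 * q - 1) = 2 * q" using assms by auto
  then have "(2 * n - 1) * ((2 * q) choose (2 * n - 1)) = (2 * q) * ((2 * q - 1) choose (2 * n - 2))"
    using Suc_times_binomial[of "2 * n - 2" "2 * q - 1"] by metis
  then have "real (2 * n - 1) * real ((2 * q) choose (2 * n - 1)) = real (2 * q) * real ((2 * q - 1) choose (2 * n - 2))"
    unfolding of_nat_mult [symmetric] by (rule arg_cong)
  moreover have "real (2 * n - 1) > 0" using assms by simp
  ultimately show ?thesis using assms by (simp add: divide_simps mult.commute)
qed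

text \<open>Rows (True, n) belong to compositions with n - 1 twos before the 3, rows (False, n) to
  those with n - 1 twos after the 1. Counting from opposite ends lets the same binomial (2q-1 choose
  2n-2), zero for q < n, govern both diagonal blocks modulo 2. Columns (True, q) and (False, q)
  stand for \<open>L_part\<close> and \<open>zeta_part\<close>.\<close>

definition coeff_matrix :: "nat \<Rightarrow> bool \<times> nat \<Rightarrow> bool \<times> nat \<Rightarrow> real" where
  "coeff_matrix m = (\<lambda>(b, n) (c, q).
     if b then
       if c then real ((2 * q - 1) choose (2 * (n - 1))) * (1 + 2 / 4 ^ q) * (4 ^ q / 2)
       else (real ((2 * q) choose (2 * (n - 1))) * ((1 - 1 / 4 ^ q) * (1 - 1 / 9 ^ q) / 2)
              - real ((2 * q) choose (2 * (m + 1 - n))) * 1) * 4 ^ q / (2 * real q)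
     else
       if c then real ((2 * q - 1) choose (2 * (m + 1 - n) - 1)) * (- 1) * (4 ^ q / 2)
       else (real ((2 * q) choose (2 * (m + 1 - n) - 1)) * ((1 / 9 ^ q - 1) / 2)
              - real ((2 * q) choose (2 * (n - 1) + 1)) * (1 / 4 ^ q - 1)) * 4 ^ q / (2 * real q))"

lemma inverse_nine_power: "1 / 9 ^ q \<in> odd_denom"
  using odd_denom_inverse_odd[of "9 ^ q"] by simp

context
  fixes n q :: nat
  assumes n: "0 < n" and q: "0 < q"
begin

lemma coeff_matrix_TT:
  "coeff_matrix m (True, n) (True, q) = real (((2 * q - 1) choose (2 * n - 2)) * (2 * 4 ^ (q - 1) + 1))"
proof -
  have "(4::real) ^ q = 4 * 4 ^ (q - 1)" using q by (cases q) auto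
  then have "(1 + 2 / 4 ^ q) * (4 ^ q / 2) = 2 * 4 ^ (q - 1) + (1::real)" by (simp add: field_simps)
  moreover have "2 * (n - 1) = 2 * n - 2" by simp
  ultimately have "coeff_matrix m (True, n) (True, q) =
      real ((2 * q - 1) choose (2 * n - 2)) * (2 * 4 ^ (q - 1) + 1)"
    by (simp only: coeff_matrix_def prod.case if_True mult.assoc)
  then show ?thesis by (simp only: of_nat_mult of_nat_add of_nat_power of_nat_numeral of_nat_1)
qed

text \<open>Up to integers and odd denominators, the two terms are twice (9^q - 1)/(8q) and twice
  4^q/(4q), both 2-integral.\<close>

lemma coeff_matrix_TF: "coeff_matrix m (True, n) (False, q) / 2 \<in> odd_denom"
proof -
  define X where "X = (9 ^ q - 1) / (8 * real q)"
  define Y where "Y = 4 ^ q / (4 * real q)"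
  have XY: "X \<in> odd_denom" "Y \<in> odd_denom"
    unfolding X_def Y_def by (rule nine_power_minus_1_div[OF q] four_power_div[OF q])+
  have "coeff_matrix m (True, n) (False, q) / 2 =
      real ((2 * q) choose (2 * (n - 1))) * (4 ^ q - 1) * X * (1 / 9 ^ q) - real ((2 * q) choose (2 * (m + 1 - n))) * Y"
    using q unfolding X_def Y_def coeff_matrix_def by (simp add: field_simps)
  also have "\<dots> \<in> odd_denom"
    by (intro odd_denom_diff odd_denom_mult XY inverse_nine_power odd_denom_power) auto
  finally show ?thesis .
qed

lemma coeff_matrix_FT: "coeff_matrix m (False, n) (True, q) / 2 \<in> odd_denom"
proof -
  have "(4::real) ^ q = 4 * 4 ^ (q - 1)" using q by (cases q) auto
  then have "coeff_matrix m (False, n) (True, q) / 2 =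
      - (real ((2 * q - 1) choose (2 * (m + 1 - n) - 1)) * 4 ^ (q - 1))"
    by (simp add: coeff_matrix_def)
  also have "\<dots> \<in> odd_denom" by (intro odd_denom_minus odd_denom_mult odd_denom_power) auto
  finally show ?thesis .
qed

text \<open>The even remainder \<open>x\<close> collects the term with 9^q - 1. The other term,
  rewritten by \<open>binomial_2q_div\<close>, visibly has an odd denominator, vanishes for q < n
  and is odd for q = n.\<close>

lemma coeff_matrix_FF:
  "\<exists>x. x / 2 \<in> odd_denom \<and> coeff_matrix m (False, n) (False, q) =
     real ((2 * q - 1) choose (2 * n - 2)) * (1 / real (2 * n - 1)) * (4 ^ q - 1) - x"
proof -
  define X where "X = (9 ^ q - 1) / (8 * real q)"
  define x where "x = 2 * (real ((2 * q) choose (2 * (m + 1 - n) - 1)) * 4 ^ q * X * (1 / 9 ^ q))"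
  have "X \<in> odd_denom" unfolding X_def by (rule nine_power_minus_1_div[OF q])
  then have "real ((2 * q) choose (2 * (m + 1 - n) - 1)) * 4 ^ q * X * (1 / 9 ^ q) \<in> odd_denom"
    by (intro odd_denom_mult inverse_nine_power odd_denom_power) auto
  then have "x / 2 \<in> odd_denom" unfolding x_def by simp
  moreover have "2 * (n - 1) + 1 = 2 * n - 1" using n by simp
  then have "coeff_matrix m (False, n) (False, q) =
      real ((2 * q) choose (2 * n - 1)) / (2 * real q) * (4 ^ q - 1) - x"
    using q unfolding x_def X_def coeff_matrix_def by (simp add: field_simps)
  ultimately show ?thesis unfolding binomial_2q_div[OF q n] by auto
qed

end

section \<open>Shape of the coefficient matrix modulo 2\<close>

lemma coeff_matrix_odd_denom:
  assumes "0 < snd i" "0 < snd j"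
  shows "coeff_matrix m i j \<in> odd_denom"
proof -
  obtain b n c q where ij: "i = (b, n)" "j = (c, q)" by (cases i, cases j) auto
  then have nq: "0 < n" "0 < q" using assms by auto
  show ?thesis
  proof (cases b; cases c)
    assume "b" "c"
    then show ?thesis using coeff_matrix_TT[OF nq, of m] ij by (simp only: odd_denom_of_nat)
  next
    assume "b" "\<not> c"
    then show ?thesis using odd_denom_half[OF coeff_matrix_TF[OF nq, of m]] ij by simp
  next
    assume "\<not> b" "c"
    then show ?thesis using odd_denom_half[OF coeff_matrix_FT[OF nq, of m]] ij by simp
  next
    assume bc: "\<not> b" "\<not> c"
    obtain x where x: "x / 2 \<in> odd_denom" "coeff_matrix m (False, n) (False, q) =
     real ((2 * q - 1) choose (2 * n - 2)) * (1 / real (2 * n - 1)) * (4 ^ q - 1) - x"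
      using coeff_matrix_FF[OF nq, of m] by blast
    have "odd (2 * n - 1)" using nq by simp
    then have "coeff_matrix m (False, n) (False, q) \<in> odd_denom" unfolding x(2)
      by (intro odd_denom_diff odd_denom_mult odd_denom_power odd_denom_half[OF x(1)] odd_denom_inverse_odd) auto
    then show ?thesis using bc ij by simp
  qed
qed

lemma coeff_matrix_diagonal:
  assumes "0 < snd i"
  shows "coeff_matrix m i i \<in> odd_unit"
proof -
  obtain b n where i: "i = (b, n)" by (cases i)
  then have n: "0 < n" using assms by simp
  \<comment> \<open>On the diagonal the binomial is an odd number, and it cancels the denominator 2n
    - 1 in the zeta block.\<close>
  have "(2 * n - 1) choose (2 * n - 2) = 2 * n - 1"
    using binomial_Suc_n[of "2 * n - 2"] n by (simp add: Suc_diff_Suc numeral_2_eq_2)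
  note binomial = this
  have "odd (2 * n - 1)" using n by simp
  show ?thesis
  proof (cases b)
    case True
    have "odd ((2 * n - 1) * (2 * 4 ^ (n - 1) + 1))" using \<open>odd (2 * n - 1)\<close> by simp
    from odd_unit_of_nat[OF this] have "coeff_matrix m (True, n) (True, n) \<in> odd_unit"
      unfolding coeff_matrix_TT[OF n n] binomial .
    then show ?thesis using True i by simp
  next
    case False
    obtain x where x: "x / 2 \<in> odd_denom" "coeff_matrix m (False, n) (False, n) =
     real ((2 * n - 1) choose (2 * n - 2)) * (1 / real (2 * n - 1)) * (4 ^ n - 1) - x"
      using coeff_matrix_FF[OF n n, of m] by blast
    have "4 ^ n - 1 = real (4 ^ n - 1)" by (simp add: of_nat_diff)
    moreover have "odd (4 ^ n - 1 :: nat)" using n by simp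
    ultimately have "4 ^ n - (1::real) \<in> odd_unit" using odd_unit_of_nat by metis
    moreover have "real (2 * n - 1) \<noteq> 0" using \<open>odd (2 * n - 1)\<close> by (metis even_zero of_nat_eq_0_iff)
    ultimately have "coeff_matrix m (False, n) (False, n) \<in> odd_unit"
      unfolding x(2) binomial by (simp add: odd_unit_diff x(1))
    then show ?thesis using False i by simp
  qed
qed

text \<open>Mixed entries are even everywhere, which settles distinct indices of equal rank. Within
  a diagonal block i \<noteq> j forces q < n, where the governing binomial is 0.\<close>

lemma coeff_matrix_below_diagonal:
  assumes "0 < snd i" "0 < snd j" "i \<noteq> j" "snd j \<le> snd i"
  shows "coeff_matrix m i j / 2 \<in> odd_denom"
proof -
  obtain b n c q where ij: "i = (b, n)" "j = (c, q)" by (cases i, cases j) auto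
  then have nq: "0 < n" "0 < q" "q \<le> n" using assms by auto
  have zero: "(2 * q - 1) choose (2 * n - 2) = 0" if "q < n" using that nq by simp
  show ?thesis
  proof (cases b; cases c)
    assume "b" "c"
    moreover from this have "q < n" using assms ij by auto
    moreover have "coeff_matrix m (True, n) (True, q) = 0"
      unfolding coeff_matrix_TT[OF nq(1,2)] zero[OF \<open>q < n\<close>] by simp
    ultimately show ?thesis using ij by simp
  next
    assume "b" "\<not> c"
    then show ?thesis using coeff_matrix_TF[OF nq(1,2), of m] ij by simp
  next
    assume "\<not> b" "c"
    then show ?thesis using coeff_matrix_FT[OF nq(1,2), of m] ij by simp
  next
    assume bc: "\<not> b" "\<not> c"
    then have "q < n" using assms ij by auto
    obtain x where "x / 2 \<in> odd_denom" "coeff_matrix m (False, n) (False, q) = - x"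
      using coeff_matrix_FF[OF nq(1,2), of m] unfolding zero[OF \<open>q < n\<close>] by auto
    then show ?thesis using odd_denom_minus[of "x / 2"] ij bc by simp
  qed
qed

section \<open>Comparison of the two spans\<close>

definition \<sigma>_index :: "nat \<Rightarrow> bool \<times> nat \<Rightarrow> nat list" where
  "\<sigma>_index m = (\<lambda>(b, n). if b then replicate (n - 1) 2 @ [3] @ replicate (m - n) 2
     else replicate (m + 1 - n) 2 @ [1] @ replicate (n - 1) 2)"

definition part_index :: "nat \<Rightarrow> bool \<times> nat \<Rightarrow> real" where
  "part_index m = (\<lambda>(c, q). if c then L_part m q else zeta_part m q)"

lemma \<sigma>_eq_coeff_matrix:
  assumes "snd i \<in> {1..m}"
  shows "\<sigma> (\<sigma>_index m i) = (\<Sum>j\<in>UNIV \<times> {1..m}. coeff_matrix m i j * part_index m j)"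
proof -
  obtain b n where i: "i = (b, n)" by (cases i)
  have sum: "(\<Sum>j\<in>UNIV \<times> {1..m}. coeff_matrix m i j * part_index m j) =
      (\<Sum>q=1..m. coeff_matrix m i (True, q) * L_part m q + coeff_matrix m i (False, q) * zeta_part m q)"
    by (simp add: sum.cartesian_product' UNIV_bool sum.distrib part_index_def)
  show ?thesis
  proof (cases b)
    case True
    have "n - 1 + (m + 1 - n) = m" "0 < m + 1 - n" "m + 1 - n - 1 = m - n" using assms i by auto
    with \<sigma>_232_eq_sum[of "n - 1" "m + 1 - n" m] show ?thesis
      unfolding i sum[unfolded i] using True by (simp only: \<sigma>_index_def coeff_matrix_def case_prod_conv if_True if_False simp_thms)
  next
    case False
    have "m + 1 - n + (n - 1) = m" "0 < m + 1 - n" using assms i by auto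
    with \<sigma>_212_eq_sum[of "m + 1 - n" "n - 1" m] show ?thesis
      unfolding i sum[unfolded i] using False by (simp only: \<sigma>_index_def coeff_matrix_def case_prod_conv if_True if_False simp_thms)
  qed
qed

lemma compositions_V_eq: "compositions_V (2 * m + 1) = \<sigma>_index m ` (UNIV \<times> {1..m})"
proof (intro equalityI subsetI)
  fix as assume "as \<in> compositions_V (2 * m + 1)"
  then have as: "admissible as" "sum_list as = 2 * m + 1" "form_232 as \<or> form_212 as"
    by (auto simp: compositions_V_def weight_def)
  from as(3) show "as \<in> \<sigma>_index m ` (UNIV \<times> {1..m})"
  proof
    assume "form_232 as"
    then obtain i j where a: "as = replicate i 2 @ [3] @ replicate j 2" by (auto simp: form_232_def)
    have "i + j + 1 = m" using as(2) by (simp add: a sum_list_replicate)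
    then have "as = \<sigma>_index m (True, i + 1)" "i + 1 \<in> {1..m}" by (auto simp: a \<sigma>_index_def)
    then show ?thesis by blast
  next
    assume "form_212 as"
    then obtain i j where a: "as = replicate i 2 @ [1] @ replicate j 2" by (auto simp: form_212_def)
    have ij: "i + j = m" using as(2) by (simp add: a sum_list_replicate)
    moreover have "i \<noteq> 0" using as(1) by (cases i) (auto simp: a admissible_def)
    ultimately have "m + 1 - (j + 1) = i" "j + 1 \<in> {1..m}" by auto
    then have "as = \<sigma>_index m (False, j + 1)" "j + 1 \<in> {1..m}" by (auto simp: a \<sigma>_index_def)
    then show ?thesis by blast
  qed
next
  fix as assume "as \<in> \<sigma>_index m ` (UNIV \<times> {1..m})"
  then obtain b n where as: "as = \<sigma>_index m (b, n)" and n: "1 \<le> n" "n \<le> m" by auto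
  show "as \<in> compositions_V (2 * m + 1)"
  proof (cases b)
    case True
    then have a: "as = replicate (n - 1) 2 @ [3] @ replicate (m - n) 2" by (simp add: as \<sigma>_index_def)
    have "admissible as" by (cases "n - 1") (auto simp: a admissible_def composition_def)
    moreover have "weight as = 2 * m + 1" using n by (simp add: a weight_def sum_list_replicate)
    moreover have "form_232 as" unfolding a form_232_def by blast
    ultimately show ?thesis by (simp add: compositions_V_def)
  next
    case False
    then have a: "as = replicate (m + 1 - n) 2 @ [1] @ replicate (n - 1) 2" by (simp add: as \<sigma>_index_def)
    obtain i where i: "m + 1 - n = Suc i" using n by (metis Suc_diff_le Suc_eq_plus1)
    have "admissible as" unfolding a i by (auto simp: admissible_def composition_def)
    moreover have "weight as = 2 * m + 1" using n by (simp add: a weight_def sum_list_replicate)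
    moreover have "form_212 as" unfolding a form_212_def by blast
    ultimately show ?thesis by (simp add: compositions_V_def)
  qed
qed

text \<open>One inclusion is rationality of the matrix entries, the other is elimination over the
  local ring, with the second index component as rank.\<close>

lemma rat_span_\<sigma>_eq:
  "rat_span (\<sigma> ` compositions_V (2 * m + 1)) = rat_span (part_index m ` (UNIV \<times> {1..m}))"
proof
  define I where "I = (UNIV :: bool set) \<times> {1..m}"
  have eq: "\<sigma> (\<sigma>_index m i) = (\<Sum>j\<in>I. coeff_matrix m i j * part_index m j)" if "i \<in> I" for i
    using \<sigma>_eq_coeff_matrix[of i m] that by (auto simp: I_def)
  have image: "\<sigma> ` compositions_V (2 * m + 1) = (\<lambda>i. \<sigma> (\<sigma>_index m i)) ` I"
    unfolding compositions_V_eq I_def by (simp add: image_image)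
  have "\<sigma> (\<sigma>_index m i) \<in> rat_span (part_index m ` I)" if "i \<in> I" for i
    unfolding eq[OF that] using that
    by (intro rat_span_sum rat_span_mult rat_span_base odd_denom_Rats coeff_matrix_odd_denom) (auto simp: I_def)
  then show "rat_span (\<sigma> ` compositions_V (2 * m + 1)) \<subseteq> rat_span (part_index m ` (UNIV \<times> {1..m}))"
    unfolding image I_def [symmetric] by (intro rat_span_minimal) auto
  have "\<forall>j\<in>I. part_index m j \<in> rat_span ((\<lambda>i. \<sigma> (\<sigma>_index m i)) ` I)"
    by (rule rat_span_triangular_mod_2[where M = "coeff_matrix m" and rank = snd])
      (auto simp: eq, auto simp: I_def intro!: coeff_matrix_odd_denom coeff_matrix_diagonal coeff_matrix_below_diagonal)
  then show "rat_span (part_index m ` (UNIV \<times> {1..m})) \<subseteq> rat_span (\<sigma> ` compositions_V (2 * m + 1))"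
    unfolding image I_def [symmetric] by (intro rat_span_minimal) auto
qed

lemma rat_span_part_index:
  "rat_span (part_index m ` (UNIV \<times> {1..m})) = rat_span
    ({pi ^ (2 * m + 1 - 2 * r) * sqrt 3 * L_series (2 * r) chi3 | r. r \<in> {1..m}} \<union>
     {pi ^ (2 * m - 2 * r) * zeta (2 * r + 1) | r. r \<in> {1..m}})" (is "_ = rat_span ?S")
proof
  define a where "a q = (- 1) ^ Suc q * (1 / (3::real) ^ (2 * m + 1 - 2 * q) / fact (2 * m + 1 - 2 * q)) * (2 / 4 ^ q)" for q
  define b where "b q = 2 * (- 1) ^ Suc q * (1 / (3::real) ^ (2 * m - 2 * q) / fact (2 * m - 2 * q)) * (2 * real q / 4 ^ q)" for q
  have rat: "a q \<in> \<rat>" "b q \<in> \<rat>" for q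
  proof -
    have "fact n \<in> (\<rat> :: real set)" for n by (metis Rats_of_nat of_nat_fact)
    then show "a q \<in> \<rat>" "b q \<in> \<rat>"
      unfolding a_def b_def by (auto intro!: Rats_mult Rats_divide Rats_power)
  qed
  \<comment> \<open>The scaling of the zeta values contains the factor q, so q >= 1 matters
    here.\<close>
  have nz: "a q \<noteq> 0" "b q \<noteq> 0" if "q \<in> {1..m}" for q using that by (auto simp: a_def b_def)
  have L: "L_part m q = a q * (pi ^ (2 * m + 1 - 2 * q) * sqrt 3 * L_series (2 * q) chi3)" for q
    by (simp add: L_part_def a_def power_divide)
  have Z: "zeta_part m q = b q * (pi ^ (2 * m - 2 * q) * zeta (2 * q + 1))" for q
    by (simp add: zeta_part_def b_def power_divide)
  show "rat_span (part_index m ` (UNIV \<times> {1..m})) \<subseteq> rat_span ?S"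
  proof (intro rat_span_minimal subsetI)
    fix x assume "x \<in> part_index m ` (UNIV \<times> {1..m})"
    then obtain q where q: "q \<in> {1..m}" "x = L_part m q \<or> x = zeta_part m q"
      by (auto simp: part_index_def split: if_splits)
    then show "x \<in> rat_span ?S"
      unfolding L Z by (elim disjE) (simp_all only:, (intro rat_span_mult rat rat_span_base; blast)+)
  qed
  show "rat_span ?S \<subseteq> rat_span (part_index m ` (UNIV \<times> {1..m}))"
  proof (intro rat_span_minimal subsetI)
    fix x assume "x \<in> ?S"
    then obtain q where q: "q \<in> {1..m}" and
      "x = pi ^ (2 * m + 1 - 2 * q) * sqrt 3 * L_series (2 * q) chi3 \<or> x = pi ^ (2 * m - 2 * q) * zeta (2 * q + 1)"
      by blast
    then have x: "x = inverse (a q) * L_part m q \<or> x = inverse (b q) * zeta_part m q"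
      unfolding L Z using nz[OF q] by auto
    have "L_part m q = part_index m (True, q)" "zeta_part m q = part_index m (False, q)"
      by (simp_all add: part_index_def)
    then have "L_part m q \<in> rat_span (part_index m ` (UNIV \<times> {1..m}))"
      "zeta_part m q \<in> rat_span (part_index m ` (UNIV \<times> {1..m}))"
      using q by (auto intro!: rat_span_base)
    then show "x \<in> rat_span (part_index m ` (UNIV \<times> {1..m}))"
      using x rat_span_mult Rats_inverse[OF rat(1)] Rats_inverse[OF rat(2)] by blast
  qed
qed

theorem theorem7:
  fixes k :: nat and V :: "real set"
  assumes "0 < k" and "odd k"
    and "V = rat_span (\<sigma> ` compositions_V k)"
  shows "V = rat_span
    ({pi ^ (k - 2 * r) * sqrt 3 * L_series (2 * r) chi3 | r. 1 \<le> r \<and> r \<le> (k - 1) div 2} \<union>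
     {pi ^ (k - 2 * r - 1) * zeta (2 * r + 1) | r. 1 \<le> r \<and> r \<le> (k - 1) div 2})"
proof -
  obtain m where k: "k = 2 * m + 1" using assms(2) by (elim oddE)
  have "k - 2 * r - 1 = 2 * m - 2 * r" for r using k by simp
  then show ?thesis
    using assms(3) unfolding k rat_span_\<sigma>_eq rat_span_part_index by simp
qed

end
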